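(* Let $F$ be an algebraically closed field of characteristic $0$, let $f \in F\langle \mathcal{X}\rangle$ be a noncommutative polynomial of degree $m \ge 1$, and let $\mathcal{A} = M_n(F)$ with $n \ge 2$ and $n \ge m-1$. Let $\alpha_1, \alpha_2, \alpha_3$ be nonzero elements of $F$ such that $\alpha_1 + \alpha_2 + \alpha_3 = 0$. Then every trace zero matrix $T \in \mathcal{A}$ can be written as $$T = \alpha_1 A_1 + \alpha_2 A_2 + \alpha_3 A_3$$ for some $A_1, A_2, A_3 \in f(\mathcal{A})$.
   Context: $M_n(F)$ denotes the algebra of all $n \times n$ matrices over the field $F$. $F\langle \mathcal{X}\rangle$ denotes the free (unital, associative) $F$-algebra generated by the set $\mathcal{X} = \{X_1, X_2, \dots\}$; its elements are called noncommutative polynomials. If $f = f(X_1, \dots, X_k) \in F\langle \mathcal{X}\rangle$ is a noncommutative polynomial and $\mathcal{A}$ is an $F$-algebra, the image of $f$ in $\mathcal{A}$ is the set $f(\mathcal{A}) = \{ f(a_1, \dots, a_k) \mid a_1, \dots, a_k \in \mathcal{A} \}$. *)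

theory Defs
  imports
    "HOL-Library.Poly_Mapping"
    "HOL-Computational_Algebra.Polynomial"
    "Jordan_Normal_Form.Matrix"
begin

(* A word X_(i1) ... X_(ir) in the variables, stored as the list of its indices. The wrapper
   keeps lists themselves free of a plus instance: addition on words is concatenation, which
   is what the convolution product of poly_mapping expects of its exponents. *)
datatype ncword = Word (letters: "nat list")

instantiation ncword :: monoid_add
begin

definition zero_ncword :: ncword
  where "0 = Word []"

definition plus_ncword :: "ncword \<Rightarrow> ncword \<Rightarrow> ncword"
  where "v + w = Word (letters v @ letters w)"

instance
  by standard (simp_all add: zero_ncword_def plus_ncword_def)

end

(* The free unital algebra on countably many generators, as the monoid algebra of words;
   its ring operations are those of poly_mapping over a monoid. *)
type_synonym 'a ncpoly = "ncword \<Rightarrow>\<^sub>0 'a"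

(* Total degree; 0 for the zero polynomial. *)
definition ncpoly_degree :: "'a::zero ncpoly \<Rightarrow> nat"
  where "ncpoly_degree f = Max (insert 0 ((\<lambda>w. length (letters w)) ` Poly_Mapping.keys f))"

definition word_eval :: "nat \<Rightarrow> (nat \<Rightarrow> 'a::semiring_1 mat) \<Rightarrow> ncword \<Rightarrow> 'a mat"
  where "word_eval n a w = foldr (\<lambda>i B. a i * B) (letters w) (1\<^sub>m n)"

(* The sum is taken in the ring of n x n matrices, as the type of matrices of all sizes
   has no zero. *)
definition ncpoly_eval :: "nat \<Rightarrow> 'a::semiring_1 ncpoly \<Rightarrow> (nat \<Rightarrow> 'a mat) \<Rightarrow> 'a mat"
  where "ncpoly_eval n f a =
    finsum (ring_mat TYPE('a) n ()) (\<lambda>w. Poly_Mapping.lookup f w \<cdot>\<^sub>m word_eval n a w) (Poly_Mapping.keys f)"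

(* Matrices are substituted for all variables at once; those not occurring in f do not matter. *)
definition ncpoly_image :: "nat \<Rightarrow> 'a::semiring_1 ncpoly \<Rightarrow> 'a mat set"
  where "ncpoly_image n f = {ncpoly_eval n f a | a. \<forall>i. a i \<in> carrier_mat n n}"

definition mat_trace :: "'a::comm_monoid_add mat \<Rightarrow> 'a"
  where "mat_trace A = (\<Sum>i<dim_row A. A $$ (i, i))"

end

theory Submission
  imports Defs "Jordan_Normal_Form.Char_Poly" "Jordan_Normal_Form.Column_Operations"
begin

text \<open>
  It suffices to find a matrix \<open>A\<close> in the image of \<open>f\<close> with \<open>n\<close> distinct eigenvalues. The image is
  closed under conjugation, and every triangular matrix whose diagonal \<open>D\<close> lists these eigenvalues is
  similar to \<open>A\<close>. A trace zero matrix is similar to a matrix \<open>L + U\<close> with zero diagonal (\<open>L\<close> strictly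
  lower, \<open>U\<close> strictly upper triangular), and
  \<open>L + U = \<alpha>\<^sub>1 (D + L/\<alpha>\<^sub>1) + \<alpha>\<^sub>2 (D + U/\<alpha>\<^sub>2) + \<alpha>\<^sub>3 D\<close>.

  To find \<open>A\<close>, drop the constant term of \<open>f\<close> and let \<open>r + 1\<close> be the least size at which \<open>f\<close> does not vanish
  on upper bidiagonal matrices; a staircase argument gives \<open>r \<le> m div 2\<close>. On matrices of size
  \<open>N > r\<close> that are bidiagonal along a cycle, with the off-diagonal part scaled by \<open>x\<close>, the value of
  \<open>f\<close> is \<open>x\<^sup>r\<close> times a cyclic shift by \<open>r\<close> with nonzero weights, up to higher order in \<open>x\<close>. Hence
  \<open>f\<close> takes an invertible value for every \<open>N > r\<close>, and for \<open>N = r + 1\<close>, where the shift is a single cycle,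
  a value with simple spectrum. Both properties are Zariski open, so they hold simultaneously for a
  generic argument; adding a zero row and column then gives a simple spectrum in size \<open>N + 1\<close>.
\<close>

section \<open>Matrices with simple spectrum\<close>

definition diag_of :: "nat \<Rightarrow> (nat \<Rightarrow> 'a::zero) \<Rightarrow> 'a mat"
  where "diag_of n l = mat n n (\<lambda>(i, j). if i = j then l i else 0)"

lemma diag_of_carrier [simp]: "diag_of n l \<in> carrier_mat n n"
  by (simp add: diag_of_def)

lemma diag_of_mult_vec:
  assumes "c \<in> carrier_vec n"
  shows "diag_of n l *\<^sub>v c = vec n (\<lambda>i. l i * c $ i :: 'a::semiring_1)"
proof (rule eq_vecI)
  fix i assume "i < dim_vec (vec n (\<lambda>i. l i * c $ i))"
  then have i: "i < n" by simp
  have "(diag_of n l *\<^sub>v c) $ i = (\<Sum>j = 0..<n. (if i = j then l i else 0) * c $ j)"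
    using i assms by (auto simp: diag_of_def scalar_prod_def intro!: sum.cong)
  also have "\<dots> = (\<Sum>j = 0..<n. if i = j then l i * c $ j else 0)"
    by (intro sum.cong) auto
  also have "\<dots> = l i * c $ i" using i by simp
  finally show "(diag_of n l *\<^sub>v c) $ i = vec n (\<lambda>i. l i * c $ i) $ i" using i by simp
qed (simp add: diag_of_def)

lemma det_diag_of: "det (diag_of n l) = (\<Prod>i<n. l i :: 'a::comm_ring_1)"
proof -
  have "upper_triangular (diag_of n l)"
    by (auto simp: diag_of_def upper_triangular_def)
  then have "det (diag_of n l) = prod_list (diag_mat (diag_of n l))"
    by (rule det_upper_triangular) (rule diag_of_carrier)
  also have "diag_mat (diag_of n l) = map l [0..<n]"
    by (auto simp: diag_mat_def diag_of_def intro!: nth_equalityI)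
  also have "prod_list \<dots> = (\<Prod>i<n. l i)"
    by (simp add: prod.distinct_set_conv_list[symmetric] atLeast0LessThan)
  finally show ?thesis .
qed

lemma det_nonzeroI:
  fixes P :: "'a::field mat"
  assumes "P \<in> carrier_mat n n"
    and "\<And>c. c \<in> carrier_vec n \<Longrightarrow> P *\<^sub>v c = 0\<^sub>v n \<Longrightarrow> c = 0\<^sub>v n"
  shows "det P \<noteq> 0"
  using assms det_0_iff_vec_prod_zero_field[OF assms(1)] by auto

text \<open>The columns of \<open>P\<close> are eigenvectors, which gives the intertwining relation.
  Invertibility is the independence of eigenvectors for distinct eigenvalues, by induction on the
  support of a kernel vector.\<close>

lemma eigenvector_matrix:
  fixes A :: "'a::field mat"
  assumes A: "A \<in> carrier_mat n n" and inj: "inj_on l {..<n}"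
    and ev: "\<And>i. i < n \<Longrightarrow> eigenvector A (v i) (l i)"
  defines "P \<equiv> mat n n (\<lambda>(i, j). v j $ i)"
  shows "A * P = P * diag_of n l" and "det P \<noteq> 0"
proof -
  have P: "P \<in> carrier_mat n n" by (simp add: P_def)
  have v: "v i \<in> carrier_vec n" "v i \<noteq> 0\<^sub>v n" "A *\<^sub>v v i = l i \<cdot>\<^sub>v v i" if "i < n" for i
    using ev[OF that] A by (auto simp: eigenvector_def)
  have colP: "col P j = v j" if "j < n" for j
    using v[OF that] that by (intro eq_vecI) (auto simp: P_def)
  show AP: "A * P = P * diag_of n l"
  proof (rule eq_matI)
    fix i j assume "i < dim_row (P * diag_of n l)" "j < dim_col (P * diag_of n l)"
    then have ij: "i < n" "j < n" using P by (auto simp: diag_of_def)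
    have "(A * P) $$ (i, j) = (A *\<^sub>v v j) $ i"
      using A P ij colP by simp
    also have "\<dots> = l j * v j $ i" using v[OF ij(2)] ij A by simp
    also have "\<dots> = (\<Sum>k = 0..<n. if k = j then l j * v j $ i else 0)" using ij by simp
    also have "\<dots> = (\<Sum>k = 0..<n. v k $ i * (if k = j then l k else 0))"
      by (intro sum.cong) (auto simp: mult.commute)
    also have "\<dots> = (P * diag_of n l) $$ (i, j)"
      using ij by (auto simp: P_def diag_of_def scalar_prod_def intro!: sum.cong)
    finally show "(A * P) $$ (i, j) = (P * diag_of n l) $$ (i, j)" .
  qed (use A P in \<open>auto simp: diag_of_def\<close>)
  have ker: "c = 0\<^sub>v n" if "c \<in> carrier_vec n" "P *\<^sub>v c = 0\<^sub>v n" for c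
    using that
  proof (induction "card {i. i < n \<and> c $ i \<noteq> 0}" arbitrary: c rule: less_induct)
    case less
    note c = less.prems(1) and Pc = less.prems(2)
    show ?case
    proof (rule ccontr)
      assume "c \<noteq> 0\<^sub>v n"
      moreover have "c = 0\<^sub>v n" if "\<forall>i<n. c $ i = 0"
        using c that by (intro eq_vecI) auto
      ultimately obtain i where i: "i < n" "c $ i \<noteq> 0" by blast
      \<comment> \<open>Since \<open>A * P = P * diag_of n l\<close>, the map
        \<open>diag_of n l\<close> preserves the kernel of \<open>P\<close>. Subtracting
        \<open>l i\<close> times \<open>c\<close> kills coordinate \<open>i\<close> and creates no
        new nonzero coordinate, so the support shrinks.\<close>
      define c' where "c' = vec n (\<lambda>j. (l j - l i) * c $ j)"
      have c'_eq: "c' = diag_of n l *\<^sub>v c - l i \<cdot>\<^sub>v c"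
        using c by (intro eq_vecI) (auto simp: c'_def diag_of_mult_vec algebra_simps)
      have "P *\<^sub>v (diag_of n l *\<^sub>v c) = (A * P) *\<^sub>v c"
        using P c AP by (simp add: assoc_mult_mat_vec[of _ n n _ n])
      also have "\<dots> = A *\<^sub>v 0\<^sub>v n"
        using A P c Pc by (simp add: assoc_mult_mat_vec[of _ n n _ n])
      also have "\<dots> = 0\<^sub>v n" using A by (intro eq_vecI) auto
      finally have D: "P *\<^sub>v (diag_of n l *\<^sub>v c) = 0\<^sub>v n" .
      have "P *\<^sub>v c' = 0\<^sub>v n - l i \<cdot>\<^sub>v 0\<^sub>v n"
        unfolding c'_eq using P c D Pc
        by (subst mult_minus_distrib_mat_vec[of _ n n])
          (auto simp: mult_mat_vec[of _ n n] diag_of_mult_vec)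
      also have "\<dots> = 0\<^sub>v n" by (intro eq_vecI) auto
      finally have "P *\<^sub>v c' = 0\<^sub>v n" .
      moreover have "c' $ j = (l j - l i) * c $ j" if "j < n" for j
        using that by (simp add: c'_def)
      then have "{j. j < n \<and> c' $ j \<noteq> 0} \<subseteq> {j. j < n \<and> c $ j \<noteq> 0}"
        "i \<in> {j. j < n \<and> c $ j \<noteq> 0}" "i \<notin> {j. j < n \<and> c' $ j \<noteq> 0}"
        using i by auto
      then have "{j. j < n \<and> c' $ j \<noteq> 0} \<subset> {j. j < n \<and> c $ j \<noteq> 0}" by blast
      then have "card {j. j < n \<and> c' $ j \<noteq> 0} < card {j. j < n \<and> c $ j \<noteq> 0}"
        by (intro psubset_card_mono) auto
      moreover have "c' \<in> carrier_vec n" by (simp add: c'_def)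
      ultimately have "c' = 0\<^sub>v n" using less.hyps by blast
      then have "c' $ j = 0" if "j < n" for j using that by simp
      then have "(l j - l i) * c $ j = 0" if "j < n" for j
        using that by (simp add: c'_def)
      \<comment> \<open>As the \<open>l j\<close> are distinct, \<open>c\<close> is supported on
        \<open>i\<close> alone, so \<open>c $ i\<close> times the nonzero eigenvector
        \<open>v i\<close> would vanish.\<close>
      then have off: "c $ j = 0" if "j < n" "j \<noteq> i" for j
        using that inj i(1) by (auto simp: inj_on_def)
      have "v i $ k = 0" if k: "k < n" for k
      proof -
        have "0 = (P *\<^sub>v c) $ k" using Pc k by simp
        also have "\<dots> = (\<Sum>j = 0..<n. v j $ k * c $ j)"
          using k c by (auto simp: P_def scalar_prod_def intro!: sum.cong)
        also have "\<dots> = (\<Sum>j = 0..<n. if j = i then v i $ k * c $ i else 0)"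
          by (intro sum.cong) (auto simp: off)
        also have "\<dots> = v i $ k * c $ i" using i by simp
        finally show ?thesis using i by simp
      qed
      then have "v i = 0\<^sub>v n" using v[OF i(1)] by (intro eq_vecI) auto
      then show False using v[OF i(1)] by simp
    qed
  qed
  show "det P \<noteq> 0" by (rule det_nonzeroI[OF P ker])
qed

text \<open>Two matrices with the same \<open>n\<close> distinct eigenvalues are similar because
  both reduce to this diagonal matrix.\<close>

lemma similar_diag_of:
  fixes A :: "'a::field mat"
  assumes A: "A \<in> carrier_mat n n" and inj: "inj_on l {..<n}"
    and ev: "\<And>i. i < n \<Longrightarrow> eigenvalue A (l i)"
  shows "similar_mat A (diag_of n l)"
proof -
  have "\<forall>i. \<exists>v. i < n \<longrightarrow> eigenvector A v (l i)"
    using ev by (auto simp: eigenvalue_def)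
  then obtain v where v: "\<And>i. i < n \<Longrightarrow> eigenvector A (v i) (l i)" by metis
  define P where "P = mat n n (\<lambda>(i, j). v j $ i)"
  have P: "P \<in> carrier_mat n n" by (simp add: P_def)
  note AP = eigenvector_matrix[OF A inj v, folded P_def]
  from det_non_zero_imp_unit[OF P AP(2), where b = "()"]
  obtain Q where Q: "Q \<in> carrier_mat n n" "P * Q = 1\<^sub>m n" "Q * P = 1\<^sub>m n"
    by (auto simp: Units_def ring_mat_def)
  have "A = A * (P * Q)" using A Q by simp
  also have "\<dots> = A * P * Q" using A P Q by (simp add: assoc_mult_mat[of _ n n _ n _ n])
  also have "\<dots> = P * diag_of n l * Q" using AP(1) by simp
  finally show ?thesis using A P Q by (intro similar_matI[of _ _ P Q n]) auto
qed

section \<open>Counting eigenvalues as roots of the characteristic polynomial\<close>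

definition eigenvalues :: "'a::field mat \<Rightarrow> 'a set"
  where "eigenvalues A = {k. eigenvalue A k}"

lemma eigenvalues_roots:
  "A \<in> carrier_mat n n \<Longrightarrow> eigenvalues A = {k. poly (char_poly A) k = 0}"
  by (simp add: eigenvalues_def eigenvalue_root_char_poly)

lemma char_poly_nonzero: "A \<in> carrier_mat n n \<Longrightarrow> char_poly A \<noteq> (0 :: 'a::field poly)"
  using degree_monic_char_poly[of A n] by auto

lemma finite_eigenvalues: "A \<in> carrier_mat n n \<Longrightarrow> finite (eigenvalues A)"
  by (simp add: eigenvalues_roots char_poly_nonzero poly_roots_finite)

lemma card_eigenvalues_le: "A \<in> carrier_mat n n \<Longrightarrow> card (eigenvalues A) \<le> n"
  using card_poly_roots_bound[OF char_poly_nonzero[of A n]] degree_monic_char_poly[of A n]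
  by (simp add: eigenvalues_roots)

text \<open>A root shared with the derivative is still a root of the cofactor \<open>q\<close>, so
  \<open>p\<close> would have no more roots than \<open>q\<close>, whose degree is one less.\<close>

lemma pderiv_nonzero_at_roots:
  fixes p :: "'a::field poly"
  assumes "p \<noteq> 0" and card: "card {x. poly p x = 0} = degree p" and x: "poly p x = 0"
  shows "poly (pderiv p) x \<noteq> 0"
proof
  assume d: "poly (pderiv p) x = 0"
  from x obtain q where q: "p = [:-x, 1:] * q" by (auto simp: poly_eq_0_iff_dvd elim: dvdE)
  then have "pderiv p = q + [:-x, 1:] * pderiv q"
    by (simp add: pderiv_mult pderiv_pCons del: mult_pCons_left)
  with d have "poly q x = 0" by simp
  then have "{y. poly p y = 0} = {y. poly q y = 0}" using q by auto
  moreover have "q \<noteq> 0" using q \<open>p \<noteq> 0\<close> by auto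
  moreover have "degree p = Suc (degree q)"
    using \<open>q \<noteq> 0\<close> q by (simp add: degree_mult_eq del: mult_pCons_left)
  ultimately show False using card card_poly_roots_bound[of q] by simp
qed

text \<open>Over an algebraically closed field \<open>p\<close> splits into linear factors, and a
  repeated factor would give a root of the derivative as well.\<close>

lemma card_roots_eq_degree:
  fixes p :: "'a::alg_closed_field poly"
  assumes "p \<noteq> 0" and sep: "\<And>x. poly p x = 0 \<Longrightarrow> poly (pderiv p) x \<noteq> 0"
  shows "card {x. poly p x = 0} = degree p"
proof -
  obtain A where A: "size A = degree p" "p = Polynomial.smult (lead_coeff p) (\<Prod>x\<in>#A. [:-x, 1:])"
    using alg_closed_imp_factorization[OF assms(1)] by blast
  have cnt: "count A x \<le> 1" for x
  proof (rule ccontr)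
    assume "\<not> count A x \<le> 1"
    then have "{#x, x#} \<subseteq># A" by (auto simp: subseteq_mset_def)
    then obtain B where "A = {#x, x#} + B" by (auto simp: mset_subset_eq_exists_conv)
    then have p: "p = [:-x, 1:] * ([:-x, 1:] * Polynomial.smult (lead_coeff p) (\<Prod>x\<in>#B. [:-x, 1:]))"
      (is "p = _ * (_ * ?q)")
      by (subst A(2)) (simp del: mult_pCons_left)
    have "pderiv p = [:-x, 1:] * pderiv ([:-x, 1:] * ?q) + [:-x, 1:] * ?q * pderiv [:-x, 1:]"
      by (subst p, subst pderiv_mult) simp
    then have "poly (pderiv p) x = 0" by simp
    moreover have "poly p x = 0" by (subst p) simp
    ultimately show False using sep by blast
  qed
  have lc: "lead_coeff p \<noteq> 0" using assms(1) by simp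
  have "poly p x = lead_coeff p * (\<Prod>y\<in>#A. x - y)" for x
    by (subst A(2)) (simp add: poly_prod_mset image_mset.compositionality o_def)
  then have "{x. poly p x = 0} = set_mset A"
    using lc by (auto simp: prod_mset_zero_iff)
  moreover have "card (set_mset A) = size A"
  proof -
    have "count A x = 1" if "x \<in># A" for x
    proof -
      have "count A x > 0" using that by simp
      then show ?thesis using cnt[of x] by linarith
    qed
    then show ?thesis by (simp add: size_multiset_overloaded_eq)
  qed
  ultimately show ?thesis using A(1) by simp
qed

section \<open>Simplicity of the spectrum as a polynomial condition\<close>

text \<open>The derivative of the characteristic polynomial, evaluated at the matrix itself: its determinant is
  the discriminant up to sign, which makes simplicity of the spectrum a polynomial condition.\<close>

definition char_deriv_mat :: "nat \<Rightarrow> 'a::comm_ring_1 mat \<Rightarrow> 'a mat"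
  where "char_deriv_mat n A =
    mat n n (\<lambda>(i, j). \<Sum>k<n. of_nat (Suc k) * coeff (char_poly A) (Suc k) * (A ^\<^sub>m k) $$ (i, j))"

lemma char_deriv_mat_carrier [simp]: "char_deriv_mat n A \<in> carrier_mat n n"
  by (simp add: char_deriv_mat_def)

text \<open>Characteristic polynomial and matrix powers commute with ring homomorphisms, here
  evaluation at \<open>x\<close>. In a one-parameter family the condition thus depends polynomially
  on the parameter.\<close>

lemma char_deriv_mat_hom:
  assumes "A \<in> carrier_mat n n"
  shows "char_deriv_mat n (map_mat (\<lambda>p. poly p x) A) = map_mat (\<lambda>p. poly p x) (char_deriv_mat n A)"
proof (rule eq_matI)
  fix i j assume "i < dim_row (map_mat (\<lambda>p. poly p x) (char_deriv_mat n A))"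
    "j < dim_col (map_mat (\<lambda>p. poly p x) (char_deriv_mat n A))"
  then have ij: "i < n" "j < n" by (auto simp: char_deriv_mat_def)
  have pow: "map_mat (\<lambda>p. poly p x) A ^\<^sub>m k = map_mat (\<lambda>p. poly p x) (A ^\<^sub>m k)" for k
    by (rule semiring_hom.mat_hom_pow[OF poly_hom.semiring_hom_axioms assms, symmetric])
  have "dim_row (A ^\<^sub>m k) = n" "dim_col (A ^\<^sub>m k) = n" for k
    using pow_carrier_mat[OF assms, of k] by auto
  then show "char_deriv_mat n (map_mat (\<lambda>p. poly p x) A) $$ (i, j)
      = map_mat (\<lambda>p. poly p x) (char_deriv_mat n A) $$ (i, j)"
    using ij by (simp add: char_deriv_mat_def pow comm_ring_hom.char_poly_hom[OF poly_hom.comm_ring_hom_axioms assms] poly_sum)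
qed (auto simp: char_deriv_mat_def)

lemma poly_altdef_le:
  assumes "degree p \<le> n"
  shows "poly p x = (\<Sum>k\<le>n. coeff p k * x ^ k :: 'a::comm_semiring_1)"
  unfolding poly_altdef
  using assms by (intro sum.mono_neutral_left) (auto simp: coeff_eq_0)

lemma char_deriv_mat_eigenvector:
  fixes A :: "'a::field mat"
  assumes A: "A \<in> carrier_mat n n" and ev: "eigenvector A v c"
  shows "char_deriv_mat n A *\<^sub>v v = poly (pderiv (char_poly A)) c \<cdot>\<^sub>v v"
proof (rule eq_vecI)
  have v: "v \<in> carrier_vec n" using ev A by (auto simp: eigenvector_def)
  fix i assume "i < dim_vec (poly (pderiv (char_poly A)) c \<cdot>\<^sub>v v)"
  then have i: "i < n" using v by auto
  let ?a = "\<lambda>k. of_nat (Suc k) * coeff (char_poly A) (Suc k)"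
  have pow: "(\<Sum>j = 0..<n. (A ^\<^sub>m k) $$ (i, j) * v $ j) = c ^ k * v $ i" for k
  proof -
    have "(A ^\<^sub>m k *\<^sub>v v) $ i = c ^ k * v $ i"
      using eigenvector_pow[OF A ev, of k] v i by simp
    then show ?thesis
      using i v pow_mat_dim_square[OF A, of k] by (simp add: scalar_prod_def)
  qed
  \<comment> \<open>The derivative has degree at most \<open>n - 1\<close>, so the \<open>n\<close>
    coefficients kept in \<open>char_deriv_mat\<close> are all of them.\<close>
  have deg: "degree (pderiv (char_poly A)) \<le> n - 1"
    using degree_monic_char_poly[OF A] degree_pderiv_le[of "char_poly A"] by simp
  have n: "n > 0" using i by simp
  have "poly (pderiv (char_poly A)) c = (\<Sum>k\<le>n - 1. ?a k * c ^ k)"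
    by (subst poly_altdef_le[OF deg]) (simp add: coeff_pderiv)
  also have "{..n - 1} = {..<n}" using n by auto
  finally have p: "poly (pderiv (char_poly A)) c = (\<Sum>k<n. ?a k * c ^ k)" .
  have "(char_deriv_mat n A *\<^sub>v v) $ i = (\<Sum>j = 0..<n. (\<Sum>k<n. ?a k * (A ^\<^sub>m k) $$ (i, j)) * v $ j)"
    using i v by (simp add: char_deriv_mat_def scalar_prod_def)
  also have "\<dots> = (\<Sum>k<n. ?a k * (\<Sum>j = 0..<n. (A ^\<^sub>m k) $$ (i, j) * v $ j))"
    unfolding sum_distrib_right sum_distrib_left by (subst sum.swap) (simp add: mult.assoc)
  also have "\<dots> = poly (pderiv (char_poly A)) c * v $ i"
    by (simp add: pow p sum_distrib_right mult.assoc)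
  finally show "(char_deriv_mat n A *\<^sub>v v) $ i = (poly (pderiv (char_poly A)) c \<cdot>\<^sub>v v) $ i"
    using i v by simp
qed (use ev A in \<open>auto simp: char_deriv_mat_def eigenvector_def\<close>)

text \<open>In an eigenbasis \<open>char_deriv_mat\<close> is diagonal, with the values of the
  derivative at the simple roots as entries. Conversely, an eigenvector for a multiple root lies in
  its kernel.\<close>

lemma simple_spectrum_iff_det:
  fixes A :: "'a::alg_closed_field mat"
  assumes A: "A \<in> carrier_mat n n"
  shows "card (eigenvalues A) = n \<longleftrightarrow> det (char_deriv_mat n A) \<noteq> 0"
proof
  assume card: "card (eigenvalues A) = n"
  obtain l where l: "bij_betw l {..<n} (eigenvalues A)"
    using ex_bij_betw_nat_finite[OF finite_eigenvalues[OF A]] card by (auto simp: atLeast0LessThan)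
  then have inj: "inj_on l {..<n}" and ev: "\<And>i. i < n \<Longrightarrow> l i \<in> eigenvalues A"
    by (auto simp: bij_betw_def)
  then have "\<forall>i. \<exists>v. i < n \<longrightarrow> eigenvector A v (l i)"
    by (auto simp: eigenvalues_def eigenvalue_def)
  then obtain v where v: "\<And>i. i < n \<Longrightarrow> eigenvector A (v i) (l i)" by metis
  let ?d = "\<lambda>i. poly (pderiv (char_poly A)) (l i)"
  let ?B = "char_deriv_mat n A"
  define P where "P = mat n n (\<lambda>(i, j). v j $ i)"
  have P: "P \<in> carrier_mat n n" by (simp add: P_def)
  have detP: "det P \<noteq> 0" using eigenvector_matrix(2)[OF A inj v] by (simp add: P_def)
  have vc: "v i \<in> carrier_vec n" if "i < n" for i
    using v[OF that] A by (auto simp: eigenvector_def)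
  have BP: "?B * P = P * diag_of n ?d"
  proof (rule eq_matI)
    fix i j assume "i < dim_row (P * diag_of n ?d)" "j < dim_col (P * diag_of n ?d)"
    then have ij: "i < n" "j < n" using P by (auto simp: diag_of_def)
    have col: "col P j = v j" using vc[OF ij(2)] ij by (intro eq_vecI) (auto simp: P_def)
    have "(?B * P) $$ (i, j) = (?B *\<^sub>v v j) $ i"
      using P ij col by (simp add: char_deriv_mat_def)
    also have "\<dots> = ?d j * v j $ i"
      using char_deriv_mat_eigenvector[OF A v[OF ij(2)]] vc[OF ij(2)] ij by simp
    also have "\<dots> = (\<Sum>k = 0..<n. if k = j then ?d j * v j $ i else 0)" using ij by simp
    also have "\<dots> = (\<Sum>k = 0..<n. v k $ i * (if k = j then ?d k else 0))"
      by (intro sum.cong) (auto simp: mult.commute)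
    also have "\<dots> = (P * diag_of n ?d) $$ (i, j)"
      using ij by (auto simp: P_def diag_of_def scalar_prod_def intro!: sum.cong)
    finally show "(?B * P) $$ (i, j) = (P * diag_of n ?d) $$ (i, j)" .
  qed (use P in \<open>auto simp: diag_of_def char_deriv_mat_def\<close>)
  have "?d i \<noteq> 0" if "i < n" for i
    using pderiv_nonzero_at_roots[OF char_poly_nonzero[OF A]] card ev[OF that]
      degree_monic_char_poly[OF A] by (simp add: eigenvalues_roots[OF A])
  then have "det (diag_of n ?d) \<noteq> 0" by (simp add: det_diag_of)
  moreover have "det ?B * det P = det P * det (diag_of n ?d)"
    using arg_cong[OF BP, of det] P
    by (simp add: det_mult[of _ n])
  ultimately show "det ?B \<noteq> 0" using detP by auto
next
  assume det: "det (char_deriv_mat n A) \<noteq> 0"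
  have "poly (pderiv (char_poly A)) k \<noteq> 0" if root: "poly (char_poly A) k = 0" for k
  proof
    assume d: "poly (pderiv (char_poly A)) k = 0"
    from root obtain v where v: "eigenvector A v k"
      using eigenvalue_root_char_poly[OF A, of k] by (auto simp: eigenvalue_def)
    have "char_deriv_mat n A *\<^sub>v v = 0 \<cdot>\<^sub>v v"
      using char_deriv_mat_eigenvector[OF A v] d by simp
    moreover have "v \<in> carrier_vec n" "v \<noteq> 0\<^sub>v n" using v A by (auto simp: eigenvector_def)
    ultimately have "det (char_deriv_mat n A) = 0"
      by (subst det_0_iff_vec_prod_zero_field[OF char_deriv_mat_carrier]) (auto intro!: exI[of _ v])
    with det show False by simp
  qed
  then show "card (eigenvalues A) = n"
    using card_roots_eq_degree[OF char_poly_nonzero[OF A]] degree_monic_char_poly[OF A]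
    by (simp add: eigenvalues_roots[OF A])
qed

text \<open>The determinant along the family is a polynomial in the parameter, and one nonzero value
  shows that it is not the zero polynomial. This is how a single good parameter yields generic
  ones.\<close>

lemma finite_det_zero:
  fixes M :: "'a::field poly mat"
  assumes x: "det (map_mat (\<lambda>p. poly p x) M) \<noteq> 0"
  shows "finite {y. det (map_mat (\<lambda>p. poly p y) M) = 0}"
proof -
  have det: "det (map_mat (\<lambda>p. poly p y) M) = poly (det M) y" for y
    by (rule comm_ring_hom.hom_det[OF poly_hom.comm_ring_hom_axioms])
  then have "det M \<noteq> 0" using x by auto
  then show ?thesis by (simp add: det poly_roots_finite)
qed

lemma finite_nonsimple_spectrum:
  fixes M :: "'a::alg_closed_field poly mat"
  assumes M: "M \<in> carrier_mat n n"
    and x: "card (eigenvalues (map_mat (\<lambda>p. poly p x) M)) = n"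
  shows "finite {y. card (eigenvalues (map_mat (\<lambda>p. poly p y) M)) \<noteq> n}"
proof -
  have iff: "card (eigenvalues (map_mat (\<lambda>p. poly p y) M)) = n
      \<longleftrightarrow> det (map_mat (\<lambda>p. poly p y) (char_deriv_mat n M)) \<noteq> 0" for y
    using M by (subst simple_spectrum_iff_det[of _ n]) (auto simp: char_deriv_mat_hom[OF M])
  show ?thesis
    using finite_det_zero[of x "char_deriv_mat n M"] x by (simp add: iff)
qed

section \<open>Walks on a bidiagonal pattern\<close>

text \<open>Sum over the walks \<open>p \<rightarrow> \<dots> \<rightarrow> p + d\<close> spelling the given word, where letter \<open>i\<close> either stays at a
  vertex \<open>q\<close> with weight \<open>s q i\<close> or steps to \<open>q + 1\<close> with weight \<open>t q i\<close>.\<close>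

fun walk :: "(nat \<Rightarrow> nat \<Rightarrow> 'a::comm_semiring_1) \<Rightarrow> (nat \<Rightarrow> nat \<Rightarrow> 'a) \<Rightarrow> nat \<Rightarrow> nat \<Rightarrow> nat list \<Rightarrow> 'a"
  where
    "walk s t p d [] = (if d = 0 then 1 else 0)"
  | "walk s t p 0 (i # w) = s p i * walk s t p 0 w"
  | "walk s t p (Suc d) (i # w) = s p i * walk s t p (Suc d) w + t p i * walk s t (Suc p) d w"

text \<open>The bounds differ because a loop may occur at the final vertex \<open>p + d\<close>,
  whereas no step starts there.\<close>

lemma walk_cong:
  assumes "\<And>q. p \<le> q \<Longrightarrow> q \<le> p + d \<Longrightarrow> s q = s' q" "\<And>q. p \<le> q \<Longrightarrow> q < p + d \<Longrightarrow> t q = t' q"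
  shows "walk s t p d w = walk s' t' p d w"
  using assms by (induction s t p d w rule: walk.induct) simp_all

lemma walk_shift: "walk (\<lambda>q. s (q + k)) (\<lambda>q. t (q + k)) p d w = walk s t (p + k) d w"
  by (induction "\<lambda>q. s (q + k)" "\<lambda>q. t (q + k)" p d w rule: walk.induct) simp_all

text \<open>Shifting by the multiple \<open>N * (p div N)\<close> does not change periodic weights.
  Walks on a cycle with \<open>N\<close> vertices are therefore well defined.\<close>

lemma walk_mod:
  assumes "\<And>q. s (q mod N) = s q" "\<And>q. t (q mod N) = t q"
  shows "walk s t (p mod N) d w = walk s t p d w"
proof -
  have "u (q + N * k) = u q" if "\<And>q. u (q mod N) = u q" for u :: "nat \<Rightarrow> nat \<Rightarrow> 'a" and q k
    using that[of "q + N * k"] that[of q] by simp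
  then have "(\<lambda>q. s (q + N * (p div N))) = s" "(\<lambda>q. t (q + N * (p div N))) = t"
    using assms by auto
  then show ?thesis using walk_shift[of s "N * (p div N)" t "p mod N" d w] by simp
qed

lemma poly_walk: "poly (walk S T p d w) x = walk (\<lambda>q i. poly (S q i) x) (\<lambda>q i. poly (T q i) x) p d w"
  by (induction S T p d w rule: walk.induct) simp_all

text \<open>This is the entry at \<open>(p, p + d)\<close> of the polynomial with words
  \<open>W\<close> and coefficients \<open>c\<close>, evaluated at bidiagonal matrices with
  diagonals \<open>s\<close> and superdiagonals \<open>t\<close>.\<close>

definition walk_sum :: "nat list set \<Rightarrow> (nat list \<Rightarrow> 'a::comm_semiring_1) \<Rightarrow>
    (nat \<Rightarrow> nat \<Rightarrow> 'a) \<Rightarrow> (nat \<Rightarrow> nat \<Rightarrow> 'a) \<Rightarrow> nat \<Rightarrow> nat \<Rightarrow> 'a"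
  where "walk_sum W c s t p d = (\<Sum>w\<in>W. c w * walk s t p d w)"

lemma walk_sum_shift:
  "walk_sum W c (\<lambda>q. s (q + k)) (\<lambda>q. t (q + k)) p d = walk_sum W c s t (p + k) d"
  by (simp add: walk_sum_def walk_shift)

lemma poly_walk_sum:
  "poly (walk_sum W (\<lambda>w. [:c w:]) S T p d) x =
    walk_sum W c (\<lambda>q i. poly (S q i) x) (\<lambda>q i. poly (T q i) x) p d"
  by (simp add: walk_sum_def poly_sum poly_walk)

lemma ex_poly_nonzero:
  fixes Q :: "'a::field_char_0 poly"
  assumes "coeff Q k \<noteq> 0"
  shows "\<exists>x. poly Q x \<noteq> 0"
  using assms poly_all_0_iff_0[of Q] by auto

text \<open>The walk is split at the letter that leaves \<open>p\<close>: the \<open>k\<close>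
  letters before it loop at \<open>p\<close>, so all equal \<open>j\<close> and contribute
  \<open>x ^ k\<close>, and the leaving letter must be \<open>i\<close>.\<close>

lemma walk_peel:
  assumes "s p = (\<lambda>a. if a = j then x else 0)" "t p = (\<lambda>a. if a = i then 1 else 0)"
  shows "walk s t p (Suc d) w =
    (\<Sum>k<length w. x ^ k * (if set (take k w) \<subseteq> {j} \<and> w ! k = i
      then walk s t (Suc p) d (drop (Suc k) w) else 0))"
proof (induction w)
  case (Cons a w)
  show ?case
  proof (cases "a = j")
    case True
    then show ?thesis
      by (simp add: Cons.IH assms sum.lessThan_Suc_shift sum_distrib_left mult.assoc del: sum.lessThan_Suc)
        (auto simp: add.commute cong: if_cong)
  next
    case False
    then show ?thesis
      by (simp add: assms sum.lessThan_Suc_shift del: sum.lessThan_Suc)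
  qed
qed simp

text \<open>Peel off the first two letters \<open>j\<close>, \<open>i\<close> of \<open>w\<^sub>0\<close>: if only \<open>j\<close> may loop at \<open>p\<close>, with weight \<open>x\<close>, and only
  \<open>i\<close> may leave \<open>p\<close>, the walk sum is a polynomial in \<open>x\<close> whose linear coefficient is the walk sum from
  \<open>p + 1\<close> over the words that started with \<open>j\<close>, \<open>i\<close>.\<close>

lemma walk_sum_nonzero:
  fixes c :: "nat list \<Rightarrow> 'a::field_char_0"
  assumes "finite W" "w\<^sub>0 \<in> W" "c w\<^sub>0 \<noteq> 0" "length w\<^sub>0 = 2 * d \<or> length w\<^sub>0 = Suc (2 * d)"
  shows "\<exists>s t. walk_sum W c s t p d \<noteq> 0"
  using assms
\<comment> \<open>Every vertex left behind consumes two letters of \<open>w\<^sub>0\<close>, one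
  loop and one step; an odd length leaves one loop for the final vertex. The start \<open>p\<close>
  is generalized because it advances.\<close>
proof (induction d arbitrary: W c w\<^sub>0 p)
  case 0
  consider "w\<^sub>0 = []" | j where "w\<^sub>0 = [j]" using 0 by (auto simp: length_Suc_conv)
  then show ?case
  proof cases
    case 1
    \<comment> \<open>With all loop weights zero and no step to take, only the empty word
      survives.\<close>
    have "walk (\<lambda>_ _. 0) t p 0 w = (if w = [] then 1 else (0 :: 'a))" for t w
      by (cases w) auto
    then have "walk_sum W c (\<lambda>_ _. 0) t p 0 = (\<Sum>w\<in>W. if w = [] then c w else 0)" for t
      unfolding walk_sum_def by (intro sum.cong) auto
    then have "walk_sum W c (\<lambda>_ _. 0) t p 0 = c []" for t
      using 0 1 by simp
    then show ?thesis using 0 1 by metis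
  next
    case (2 j)
    \<comment> \<open>Only \<open>j\<close> may loop, so a word contributes only if all its letters
      are \<open>j\<close>, and the power of \<open>x\<close> records its length. The linear
      coefficient isolates \<open>[j]\<close>.\<close>
    let ?s = "\<lambda>x (_ :: nat) a. if a = j then x else (0 :: 'a)"
    let ?h = "\<lambda>w. if set w \<subseteq> {j} then 1 else (0 :: 'a)"
    define Q where "Q = (\<Sum>w\<in>W. monom (c w * ?h w) (length w))"
    have h: "walk (?s x) t p 0 w = x ^ length w * ?h w" for x t w
      by (induction w) auto
    have "poly Q x = walk_sum W c (?s x) t p 0" for x t
      by (simp add: Q_def walk_sum_def h poly_sum poly_monom mult_ac)
    moreover have "coeff Q 1 = (\<Sum>w\<in>W. if w = [j] then c w else 0)"
      unfolding Q_def coeff_sum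
      by (intro sum.cong refl) (auto simp: coeff_monom length_Suc_conv)
    then have "coeff Q 1 \<noteq> 0" using 0 2 by simp
    then have "\<exists>x. poly Q x \<noteq> 0" by (rule ex_poly_nonzero)
    ultimately show ?thesis by metis
  qed
next
  case (Suc d)
  then have "2 \<le> length w\<^sub>0" by auto
  then obtain j i v\<^sub>0 where w\<^sub>0: "w\<^sub>0 = j # i # v\<^sub>0"
    by (cases w\<^sub>0; cases "tl w\<^sub>0") auto
  define W' where "W' = {v. j # i # v \<in> W}"
  define c' where "c' = (\<lambda>v. c (j # i # v))"
  have img: "(\<lambda>v. j # i # v) ` W' \<subseteq> W" and inj: "inj_on (\<lambda>v. j # i # v) W'"
    by (auto simp: W'_def inj_on_def)
  then have "finite W'" using Suc.prems(1) finite_imageD finite_subset by blast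
  from Suc.IH[OF this, of v\<^sub>0 c' "Suc p"] Suc.prems w\<^sub>0
  obtain s' t' where st': "walk_sum W' c' s' t' (Suc p) d \<noteq> 0"
    by (auto simp: W'_def c'_def)
  \<comment> \<open>Overriding the weights at \<open>p\<close> does not affect the walks from
    \<open>Suc p\<close>, which never return to \<open>p\<close>.\<close>
  define s where "s = (\<lambda>x. s'(p := (\<lambda>a. if a = j then x else (0 :: 'a))))"
  define t where "t = t'(p := (\<lambda>a. if a = i then 1 else (0 :: 'a)))"
  define h where "h = (\<lambda>k w. if set (take k w) \<subseteq> {j} \<and> w ! k = i
      then walk s' t' (Suc p) d (drop (Suc k) w) else 0)"
  have peel: "walk (s x) t p (Suc d) w = (\<Sum>k<length w. x ^ k * h k w)" for x w
  proof -
    have "walk (s x) t (Suc p) d v = walk s' t' (Suc p) d v" for v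
      by (rule walk_cong) (auto simp: s_def t_def)
    then show ?thesis
      by (subst walk_peel[where j = j and i = i and x = x])
        (auto simp: s_def t_def h_def intro!: sum.cong)
  qed
  define Q where "Q = (\<Sum>w\<in>W. \<Sum>k<length w. monom (c w * h k w) k)"
  have Q: "poly Q x = walk_sum W c (s x) t p (Suc d)" for x
    by (simp add: Q_def walk_sum_def peel poly_sum poly_monom sum_distrib_left mult_ac)
  \<comment> \<open>Exponent 1 means exactly one loop before leaving \<open>p\<close>, so only words
    starting with \<open>j\<close>, \<open>i\<close> remain.\<close>
  have "coeff Q 1 = (\<Sum>w\<in>W. if 1 < length w then c w * h 1 w else 0)"
    unfolding Q_def coeff_sum coeff_monom by (intro sum.cong) auto
  also have "\<dots> = (\<Sum>w\<in>(\<lambda>v. j # i # v) ` W'. if 1 < length w then c w * h 1 w else 0)"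
  proof (intro sum.mono_neutral_right ballI)
    fix w assume w: "w \<in> W - (\<lambda>v. j # i # v) ` W'"
    show "(if 1 < length w then c w * h 1 w else 0) = 0"
    proof (cases "1 < length w")
      case True
      then obtain a b v where abv: "w = a # b # v"
        by (cases w; cases "tl w") auto
      then have "\<not> (a = j \<and> b = i)" using w by (auto simp: W'_def)
      then show ?thesis by (auto simp: h_def abv)
    qed simp
  qed (use Suc.prems img in auto)
  also have "\<dots> = walk_sum W' c' s' t' (Suc p) d"
    by (subst sum.reindex[OF inj]) (simp add: walk_sum_def c'_def h_def numeral_2_eq_2)
  finally have "coeff Q 1 \<noteq> 0" using st' by simp
  then obtain x where "poly Q x \<noteq> 0" using ex_poly_nonzero by blast
  then show ?case using Q by metis
qed

text \<open>For each single start the sum can be made nonzero by rotating the given weights. Starts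
  are added one at a time: on a line of weights each condition is a nonzero polynomial, and a
  product of nonzero polynomials has a nonvanishing point.\<close>

lemma walk_sum_nonzero_everywhere:
  fixes c :: "nat list \<Rightarrow> 'a::field_char_0"
  assumes nz: "walk_sum W c s\<^sub>0 t\<^sub>0 0 r \<noteq> 0" and "r < N"
  shows "\<exists>s t. (\<forall>q. s (q mod N) = s q) \<and> (\<forall>q. t (q mod N) = t q)
    \<and> (\<forall>p<N. walk_sum W c s t p r \<noteq> 0)"
proof -
  have "\<exists>s t. (\<forall>q. s (q mod N) = s q) \<and> (\<forall>q. t (q mod N) = t q)
    \<and> (\<forall>p<P. walk_sum W c s t p r \<noteq> 0)" if "P \<le> N" for P
    using that
  proof (induction P)
    case 0
    show ?case by (intro exI[of _ "\<lambda>_ _. 0"]) auto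
  next
    case (Suc P)
    then obtain s t where st: "\<And>q. s (q mod N) = s q" "\<And>q. t (q mod N) = t q"
      "\<And>p. p < P \<Longrightarrow> walk_sum W c s t p r \<noteq> 0" by auto
    \<comment> \<open>The original weights, rotated so that vertex \<open>P\<close> plays the role
      of vertex 0; adding \<open>N\<close> first keeps the natural subtraction exact.\<close>
    define s' where "s' = (\<lambda>q. s\<^sub>0 ((q + N - P) mod N))"
    define t' where "t' = (\<lambda>q. t\<^sub>0 ((q + N - P) mod N))"
    have per: "(q mod N + N - P) mod N = (q + N - P) mod N" for q
    proof -
      have "q mod N + N - P = q mod N + (N - P)" "q + N - P = q + (N - P)" using Suc.prems by auto
      then show ?thesis by (simp add: mod_add_left_eq)
    qed
    have st': "s' (q mod N) = s' q" "t' (q mod N) = t' q" for q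
      by (simp_all add: s'_def t'_def per)
    have "walk s' t' P r w = walk s\<^sub>0 t\<^sub>0 0 r w" for w
    proof -
      \<comment> \<open>Because \<open>r < N\<close>, the walk from \<open>P\<close> meets each
        vertex of the cycle at most once and sees the original weights unaltered.\<close>
      have shift: "(q + N - P) mod N = q - P" if "P \<le> q" "q \<le> P + r" for q
      proof -
        have "q + N - P = (q - P) + N" "q - P < N" using \<open>r < N\<close> that by auto
        then show ?thesis by (metis mod_add_self2 mod_less)
      qed
      have "walk s' t' P r w = walk (\<lambda>q. s\<^sub>0 (q - P)) (\<lambda>q. t\<^sub>0 (q - P)) P r w"
        by (intro walk_cong) (simp_all add: s'_def t'_def shift)
      also have "\<dots> = walk s\<^sub>0 t\<^sub>0 0 r w"
        using walk_shift[of "\<lambda>q. s\<^sub>0 (q - P)" P "\<lambda>q. t\<^sub>0 (q - P)" 0 r w] by simp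
      finally show ?thesis .
    qed
    then have nz': "walk_sum W c s' t' P r \<noteq> 0" using nz by (simp add: walk_sum_def)
    \<comment> \<open>The line through the old weights at \<open>x = 0\<close>, good for all starts
      below \<open>P\<close>, and the rotated ones at \<open>x = 1\<close>, good for
      \<open>P\<close>.\<close>
    define S where "S = (\<lambda>q i. [:s q i, s' q i - s q i:])"
    define T where "T = (\<lambda>q i. [:t q i, t' q i - t q i:])"
    define Q where "Q = (\<lambda>p. walk_sum W (\<lambda>w. [:c w:]) S T p r)"
    have Q: "poly (Q p) x = walk_sum W c (\<lambda>q i. poly (S q i) x) (\<lambda>q i. poly (T q i) x) p r" for p x
      by (simp add: Q_def poly_walk_sum)
    have "poly (Q p) 0 \<noteq> 0" if "p < P" for p
      using st(3)[OF that] by (simp add: Q S_def T_def)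
    moreover have "poly (Q P) 1 \<noteq> 0"
      using nz' by (simp add: Q S_def T_def)
    ultimately have "Q p \<noteq> 0" if "p < Suc P" for p
      using that by (metis less_Suc_eq poly_0)
    then have "(\<Prod>p<Suc P. Q p) \<noteq> 0" by auto
    then obtain x where "poly (\<Prod>p<Suc P. Q p) x \<noteq> 0" using poly_all_0_iff_0 by blast
    then have "poly (Q p) x \<noteq> 0" if "p < Suc P" for p
      using that by (auto simp: poly_prod less_Suc_eq)
    then show ?case
      using st st' by (intro exI[of _ "\<lambda>q i. poly (S q i) x"] exI[of _ "\<lambda>q i. poly (T q i) x"])
        (auto simp: Q S_def T_def)
  qed
  then show ?thesis by blast
qed

section \<open>Evaluation at matrices\<close>

definition word_mat :: "nat \<Rightarrow> (nat \<Rightarrow> 'a::semiring_1 mat) \<Rightarrow> nat list \<Rightarrow> 'a mat"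
  where "word_mat n a w = foldr (\<lambda>i B. a i * B) w (1\<^sub>m n)"

lemma word_mat_simps [simp]:
  "word_mat n a [] = 1\<^sub>m n"
  "word_mat n a (i # w) = a i * word_mat n a w"
  by (simp_all add: word_mat_def)

lemma word_mat_carrier:
  "(\<And>i. a i \<in> carrier_mat n n) \<Longrightarrow> word_mat n a w \<in> carrier_mat n n"
  by (induction w) (auto intro!: mult_carrier_mat[of _ n n _ n])

text \<open>Summing entrywise reduces matrix identities to scalar sums;
  \<open>ncpoly_eval_words\<close> relates this to the value of a noncommutative polynomial.\<close>

definition words_eval :: "nat \<Rightarrow> nat list set \<Rightarrow> (nat list \<Rightarrow> 'a::semiring_1) \<Rightarrow> (nat \<Rightarrow> 'a mat) \<Rightarrow> 'a mat"
  where "words_eval n W c a = mat n n (\<lambda>(p, q). \<Sum>w\<in>W. c w * word_mat n a w $$ (p, q))"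

lemma words_eval_carrier [simp]: "words_eval n W c a \<in> carrier_mat n n"
  by (simp add: words_eval_def)

lemma words_eval_index:
  "p < n \<Longrightarrow> q < n \<Longrightarrow> words_eval n W c a $$ (p, q) = (\<Sum>w\<in>W. c w * word_mat n a w $$ (p, q))"
  by (simp add: words_eval_def)

lemma poly_word_mat:
  assumes "\<And>i. a i \<in> carrier_mat n n"
  shows "map_mat (\<lambda>p. poly p x) (word_mat n a w) = word_mat n (\<lambda>i. map_mat (\<lambda>p. poly p x) (a i)) w"
proof (induction w)
  case Nil
  show ?case by (intro eq_matI) auto
next
  case (Cons i w)
  then show ?case
    using semiring_hom.mat_hom_mult[OF poly_hom.semiring_hom_axioms assms[of i] word_mat_carrier[OF assms]]
    by simp
qed

lemma poly_words_eval:
  assumes a: "\<And>i. a i \<in> carrier_mat n n"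
  shows "map_mat (\<lambda>p. poly p x) (words_eval n W (\<lambda>w. [:c w:]) a) =
    words_eval n W c (\<lambda>i. map_mat (\<lambda>p. poly p x) (a i))"
proof (rule eq_matI)
  fix p q assume "p < dim_row (words_eval n W c (\<lambda>i. map_mat (\<lambda>p. poly p x) (a i)))"
    "q < dim_col (words_eval n W c (\<lambda>i. map_mat (\<lambda>p. poly p x) (a i)))"
  then have pq: "p < n" "q < n" by (auto simp: words_eval_def)
  have dim: "dim_row (word_mat n a w) = n" "dim_col (word_mat n a w) = n" for w
    using word_mat_carrier[of a n w] a by auto
  have "word_mat n (\<lambda>i. map_mat (\<lambda>p. poly p x) (a i)) w $$ (p, q) = poly (word_mat n a w $$ (p, q)) x" for w
    using arg_cong[OF poly_word_mat[of a n x w], of "\<lambda>B. B $$ (p, q)"] a pq by (simp add: dim)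
  then show "map_mat (\<lambda>p. poly p x) (words_eval n W (\<lambda>w. [:c w:]) a) $$ (p, q) =
      words_eval n W c (\<lambda>i. map_mat (\<lambda>p. poly p x) (a i)) $$ (p, q)"
    using pq by (simp add: words_eval_def poly_sum)
qed (auto simp: words_eval_def)

section \<open>Values on cyclic bidiagonal matrices and their leading term\<close>

definition cyclic_mat :: "nat \<Rightarrow> (nat \<Rightarrow> nat \<Rightarrow> 'a) \<Rightarrow> (nat \<Rightarrow> nat \<Rightarrow> 'a) \<Rightarrow> 'a \<Rightarrow> nat \<Rightarrow> 'a::comm_semiring_1 mat"
  where "cyclic_mat N s t x i = mat N N (\<lambda>(p, q).
    (if q = p then s p i else 0) + (if q = Suc p mod N then x * t p i else 0))"

lemma cyclic_mat_carrier [simp]: "cyclic_mat N s t x i \<in> carrier_mat N N"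
  by (simp add: cyclic_mat_def)

text \<open>A walk with \<open>d\<close> steps ends at \<open>p + d\<close> modulo \<open>N\<close>
  and collects \<open>x ^ d\<close>. Walks with more steps than letters have weight zero, so one
  bound \<open>L\<close> can serve words of different lengths.\<close>

lemma word_mat_cyclic:
  assumes per: "\<And>q. s (q mod N) = s q" "\<And>q. t (q mod N) = t q"
    and "p < N" "q < N" "length w \<le> L"
  shows "word_mat N (cyclic_mat N s t x) w $$ (p, q) =
    (\<Sum>d\<le>L. if (p + d) mod N = q then x ^ d * walk s t p d w else 0)"
  using assms(3-5)
proof (induction w arbitrary: p L)
  case Nil
  have "(\<Sum>d\<le>L. if (p + d) mod N = q then x ^ d * walk s t p d [] else 0)
      = (\<Sum>d\<le>L. if d = 0 then (if p = q then 1 else 0) else 0)"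
    using Nil by (intro sum.cong) auto
  then show ?case using Nil by simp
next
  case (Cons i w)
  then obtain L' where L: "L = Suc L'" "length w \<le> L'" by (cases L) auto
  have N: "N > 0" using Cons.prems by simp
  let ?B = "word_mat N (cyclic_mat N s t x) w"
  let ?E = "\<lambda>d. (p + d) mod N = q"
  have B: "?B \<in> carrier_mat N N" by (simp add: word_mat_carrier)
  have "word_mat N (cyclic_mat N s t x) (i # w) $$ (p, q)
      = (\<Sum>k = 0..<N. ((if k = p then s p i else 0) + (if k = Suc p mod N then x * t p i else 0)) * ?B $$ (k, q))"
    using Cons.prems B by (auto simp: cyclic_mat_def scalar_prod_def intro!: sum.cong)
  also have "\<dots> = (\<Sum>k = 0..<N. (if k = p then s p i * ?B $$ (p, q) else 0)
      + (if k = Suc p mod N then x * t p i * ?B $$ (Suc p mod N, q) else 0))"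
    by (intro sum.cong) (auto simp: distrib_right)
  also have "\<dots> = s p i * ?B $$ (p, q) + x * t p i * ?B $$ (Suc p mod N, q)"
    using Cons.prems N by (simp add: sum.distrib)
  \<comment> \<open>A loop leaves up to \<open>Suc L'\<close> steps for the rest of the word, a step
    leaves one less; hence the two different bounds in the induction hypothesis.\<close>
  also have "?B $$ (p, q) = (\<Sum>d\<le>Suc L'. if ?E d then x ^ d * walk s t p d w else 0)"
    using Cons.IH[of p "Suc L'"] Cons.prems L by simp
  also have "\<dots> = (if ?E 0 then walk s t p 0 w else 0) +
      (\<Sum>d\<le>L'. if ?E (Suc d) then x ^ Suc d * walk s t p (Suc d) w else 0)"
    by (subst sum.atMost_Suc_shift) simp
  also have "?B $$ (Suc p mod N, q) =
      (\<Sum>d\<le>L'. if ?E (Suc d) then x ^ d * walk s t (Suc p) d w else 0)"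
    using Cons.IH[of "Suc p mod N" L'] Cons.prems L N
    by (simp add: walk_mod[of s N t, OF per] mod_add_left_eq cong: if_cong)
  finally have "word_mat N (cyclic_mat N s t x) (i # w) $$ (p, q) =
      (if ?E 0 then s p i * walk s t p 0 w else 0) +
      ((\<Sum>d\<le>L'. s p i * (if ?E (Suc d) then x ^ Suc d * walk s t p (Suc d) w else 0)) +
      (\<Sum>d\<le>L'. x * t p i * (if ?E (Suc d) then x ^ d * walk s t (Suc p) d w else 0)))"
    by (simp add: distrib_left sum_distrib_left add.assoc)
  also have "\<dots> = (if ?E 0 then walk s t p 0 (i # w) else 0) +
      (\<Sum>d\<le>L'. if ?E (Suc d) then x ^ Suc d * walk s t p (Suc d) (i # w) else 0)"
    unfolding sum.distrib[symmetric]
    by (intro arg_cong2[of _ _ _ _ plus] sum.cong) (auto simp: distrib_left mult_ac)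
  also have "\<dots> = (\<Sum>d\<le>L. if ?E d then x ^ d * walk s t p d (i # w) else 0)"
    unfolding L by (subst sum.atMost_Suc_shift) simp
  finally show ?case .
qed

definition weighted_shift :: "nat \<Rightarrow> nat \<Rightarrow> (nat \<Rightarrow> 'a) \<Rightarrow> 'a::zero mat"
  where "weighted_shift N r b = mat N N (\<lambda>(p, q). if q = (p + r) mod N then b p else 0)"

lemma weighted_shift_carrier [simp]: "weighted_shift N r b \<in> carrier_mat N N"
  by (simp add: weighted_shift_def)

text \<open>Walks with fewer than \<open>r\<close> steps contribute nothing, so \<open>x ^ r\<close>
  factors out. At \<open>x = 0\<close> the cofactor retains only the walks with exactly
  \<open>r\<close> steps.\<close>

lemma words_eval_cyclic:
  fixes c :: "nat list \<Rightarrow> 'a::comm_ring_1"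
  assumes "finite W"
    and per: "\<And>q. s (q mod N) = s q" "\<And>q. t (q mod N) = t q"
    and zero: "\<And>d p. d < r \<Longrightarrow> walk_sum W c s t p d = 0"
  obtains M :: "'a poly mat" where "M \<in> carrier_mat N N"
    "map_mat (\<lambda>p. poly p 0) M = weighted_shift N r (\<lambda>p. walk_sum W c s t p r)"
    "\<And>x. words_eval N W c (cyclic_mat N s t x) = x ^ r \<cdot>\<^sub>m map_mat (\<lambda>p. poly p x) M"
proof
  define L where "L = Max (insert 0 (length ` W))"
  define M where "M = mat N N (\<lambda>(p, q). \<Sum>e\<le>L.
    if (p + (r + e)) mod N = q then monom (walk_sum W c s t p (r + e)) e else 0)"
  show "M \<in> carrier_mat N N" by (simp add: M_def)
  have L: "length w \<le> L" if "w \<in> W" for w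
    using that \<open>finite W\<close> by (auto simp: L_def)
  show "map_mat (\<lambda>p. poly p 0) M =
      weighted_shift N r (\<lambda>p. walk_sum W c s t p r)" (is "_ = ?R")
  proof (rule eq_matI)
    fix p q assume "p < dim_row ?R" "q < dim_col ?R"
    then have pq: "p < N" "q < N" by (auto simp: weighted_shift_def)
    have "map_mat (\<lambda>p. poly p 0) M $$ (p, q) = (\<Sum>e\<le>L.
        poly (if (p + (r + e)) mod N = q then monom (walk_sum W c s t p (r + e)) e else 0) 0)"
      using pq by (simp add: M_def poly_sum)
    also have "\<dots> =
        (\<Sum>e\<le>L. if e = 0 then (if (p + r) mod N = q then walk_sum W c s t p r else 0) else 0)"
      by (intro sum.cong refl) (auto simp: poly_monom power_0_left)
    also have "\<dots> = ?R $$ (p, q)" using pq by (auto simp: weighted_shift_def)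
    finally show "map_mat (\<lambda>p. poly p 0) M $$ (p, q) = ?R $$ (p, q)" .
  qed (auto simp: M_def weighted_shift_def)
  fix x
  show "words_eval N W c (cyclic_mat N s t x) = x ^ r \<cdot>\<^sub>m map_mat (\<lambda>p. poly p x) M" (is "?L = ?R")
  proof (rule eq_matI)
    fix p q assume "p < dim_row ?R" "q < dim_col ?R"
    then have pq: "p < N" "q < N" by (auto simp: M_def)
    let ?f = "\<lambda>d. if (p + d) mod N = q then x ^ d * walk_sum W c s t p d else 0"
    have "word_mat N (cyclic_mat N s t x) w $$ (p, q) =
        (\<Sum>d\<le>r + L. if (p + d) mod N = q then x ^ d * walk s t p d w else 0)" if "w \<in> W" for w
      using word_mat_cyclic[of s N t p q w "r + L" x, OF per pq] L[OF that] by simp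
    then have "?L $$ (p, q) =
        (\<Sum>w\<in>W. c w * (\<Sum>d\<le>r + L. if (p + d) mod N = q then x ^ d * walk s t p d w else 0))"
      using pq by (simp add: words_eval_index)
    also have "\<dots> = (\<Sum>d\<le>r + L. ?f d)"
      unfolding sum_distrib_left walk_sum_def
      by (subst sum.swap) (auto intro!: sum.cong simp: mult_ac)
    also have "\<dots> = (\<Sum>d\<in>{r..r + L}. ?f d)"
      using zero by (intro sum.mono_neutral_right) auto
    also have "\<dots> = (\<Sum>e\<le>L. ?f (r + e))"
      by (rule sum.reindex_bij_witness[where i = "\<lambda>e. r + e" and j = "\<lambda>d. d - r"]) auto
    also have "\<dots> = ?R $$ (p, q)"
      using pq by (auto simp: M_def poly_sum poly_monom sum_distrib_left power_add mult_ac intro!: sum.cong)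
    finally show "?L $$ (p, q) = ?R $$ (p, q)" .
  qed (auto simp: M_def words_eval_def)
qed

section \<open>Determinant and spectrum of weighted shifts\<close>

lemma weighted_shift_mult_vec:
  assumes "v \<in> carrier_vec N" "p < N"
  shows "(weighted_shift N r b *\<^sub>v v) $ p = b p * (v $ ((p + r) mod N) :: 'a::semiring_1)"
proof -
  have "(weighted_shift N r b *\<^sub>v v) $ p =
      (\<Sum>k = 0..<N. (if k = (p + r) mod N then b p else 0) * v $ k)"
    using assms by (auto simp: weighted_shift_def scalar_prod_def intro!: sum.cong)
  also have "\<dots> = (\<Sum>k = 0..<N. if k = (p + r) mod N then b p * v $ k else 0)"
    by (intro sum.cong) auto
  also have "\<dots> = b p * v $ ((p + r) mod N)" using assms by simp
  finally show ?thesis .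
qed

lemma det_weighted_shift:
  fixes b :: "nat \<Rightarrow> 'a::field"
  assumes b: "\<And>p. p < N \<Longrightarrow> b p \<noteq> 0" and "r < N"
  shows "det (weighted_shift N r b) \<noteq> 0" (is "det ?B \<noteq> 0")
proof (rule det_nonzeroI)
  show "?B \<in> carrier_mat N N" by simp
  fix v assume v: "v \<in> carrier_vec N" "?B *\<^sub>v v = 0\<^sub>v N"
  show "v = 0\<^sub>v N"
  proof (rule eq_vecI)
    fix q assume "q < dim_vec (0\<^sub>v N)"
    then have q: "q < N" by simp
    \<comment> \<open>The vertex that the shift by \<open>r\<close> sends to \<open>q\<close>:
      subtracting \<open>r\<close> is done by adding \<open>N - r\<close>.\<close>
    define p where "p = (q + (N - r)) mod N"
    have p: "p < N" "(p + r) mod N = q"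
      using q \<open>r < N\<close> by (simp_all add: p_def mod_add_left_eq)
    have "0 = (?B *\<^sub>v v) $ p" using v p by simp
    also have "\<dots> = b p * v $ q" using weighted_shift_mult_vec[OF v(1) p(1)] p by simp
    finally show "v $ q = 0\<^sub>v N $ q" using b[OF p(1)] q by simp
  qed (use v in simp)
qed

lemma card_nth_roots:
  fixes y :: "'a::{alg_closed_field, field_char_0}"
  assumes "y \<noteq> 0" "n > 0"
  shows "card {x. x ^ n = y} = n"
proof -
  let ?p = "monom 1 n + [:-y:]"
  have deg: "degree ?p = n"
    using assms degree_add_eq_left[of "[:-y:]" "monom 1 n"] by (simp add: degree_monom_eq)
  then have "?p \<noteq> 0" using assms by auto
  then have "card {x. poly ?p x = 0} = degree ?p"
  proof (rule card_roots_eq_degree)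
    fix x assume "poly ?p x = 0"
    then have "x \<noteq> 0" using assms by (auto simp: poly_monom)
    then show "poly (pderiv ?p) x \<noteq> 0"
      using assms by (simp add: pderiv_add pderiv_monom poly_monom pderiv_pCons)
  qed
  then show ?thesis by (simp add: deg poly_monom)
qed

text \<open>Modulo \<open>r + 1\<close> a shift by \<open>r\<close> is a shift by -1, a single
  cycle. Its eigenvalues are the \<open>r + 1\<close> distinct roots of the product of the
  weights.\<close>

lemma weighted_cycle_simple_spectrum:
  fixes b :: "nat \<Rightarrow> 'a::{alg_closed_field, field_char_0}"
  assumes b: "\<And>p. p \<le> r \<Longrightarrow> b p \<noteq> 0"
  defines "B \<equiv> weighted_shift (Suc r) r b"
  shows "card (eigenvalues B) = Suc r"
proof -
  have B: "B \<in> carrier_mat (Suc r) (Suc r)" by (simp add: B_def)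
  let ?R = "{x. x ^ Suc r = (\<Prod>p<Suc r. b p)}"
  have nz: "(\<Prod>p<Suc r. b p) \<noteq> 0" using b by auto
  have "?R \<subseteq> eigenvalues B"
  proof
    fix x assume "x \<in> ?R"
    then have x: "x ^ Suc r = (\<Prod>p<Suc r. b p)" by simp
    then have x0: "x \<noteq> 0" using nz by auto
    \<comment> \<open>Solves \<open>b p * u (p - 1) = x * u p\<close> from \<open>u 0 = 1\<close>;
      closing the cycle at \<open>p = 0\<close> is exactly the equation for
      \<open>x ^ Suc r\<close>.\<close>
    define u where "u = (\<lambda>j. (\<Prod>i<j. b (Suc i)) / x ^ j)"
    define v where "v = vec (Suc r) u"
    have "B *\<^sub>v v = x \<cdot>\<^sub>v v"
    proof (rule eq_vecI)
      fix p assume "p < dim_vec (x \<cdot>\<^sub>v v)"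
      then have p: "p < Suc r" by (simp add: v_def)
      let ?q = "(p + r) mod Suc r"
      have "(B *\<^sub>v v) $ p = b p * u ?q"
        using p weighted_shift_mult_vec[of v "Suc r" p r b] by (simp add: v_def B_def)
      also have "\<dots> = x * u p"
      proof (cases p)
        case 0
        have "x ^ Suc r = b 0 * (\<Prod>i<r. b (Suc i))" using x by (simp add: prod.lessThan_Suc_shift del: prod.lessThan_Suc)
        then show ?thesis using 0 x0 by (simp add: u_def field_simps)
      next
        case (Suc j)
        then have "p + r = j + Suc r" "j < Suc r" using p by auto
        then have "?q = j" by (metis mod_add_self2 mod_less)
        then show ?thesis using Suc x0 by (simp add: u_def field_simps)
      qed
      finally show "(B *\<^sub>v v) $ p = (x \<cdot>\<^sub>v v) $ p" using p by (simp add: v_def)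
    qed (use B in \<open>simp add: v_def\<close>)
    moreover have "v $ 0 = 1" by (simp add: v_def u_def)
    then have "v \<noteq> 0\<^sub>v (Suc r)" by auto
    ultimately show "x \<in> eigenvalues B"
      using B by (auto simp: eigenvalues_def eigenvalue_def eigenvector_def v_def intro!: exI[of _ v])
  qed
  then have "card ?R \<le> card (eigenvalues B)"
    by (intro card_mono finite_eigenvalues[OF B])
  then show ?thesis
    using card_nth_roots[OF nz, of "Suc r"] card_eigenvalues_le[OF B] by simp
qed

section \<open>Scaling, and padding by a zero row and column\<close>

lemma smult_mat_mult_vec:
  assumes "A \<in> carrier_mat n m" "v \<in> carrier_vec m"
  shows "(x \<cdot>\<^sub>m A) *\<^sub>v v = x \<cdot>\<^sub>v (A *\<^sub>v v :: 'a::comm_ring_1 vec)"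
  using assms
  by (intro eq_vecI) (auto simp: scalar_prod_def sum_distrib_left mult.assoc intro!: sum.cong)

lemma card_eigenvalues_smult:
  fixes A :: "'a::field mat"
  assumes A: "A \<in> carrier_mat n n" and "card (eigenvalues A) = n" "x \<noteq> 0"
  shows "card (eigenvalues (x \<cdot>\<^sub>m A)) = n"
proof -
  have "(*) x ` eigenvalues A \<subseteq> eigenvalues (x \<cdot>\<^sub>m A)"
  proof
    fix y assume "y \<in> (*) x ` eigenvalues A"
    then obtain k v where y: "y = x * k" and v: "eigenvector A v k"
      by (auto simp: eigenvalues_def eigenvalue_def)
    then have "x \<cdot>\<^sub>m A *\<^sub>v v = y \<cdot>\<^sub>v v"
      using A by (auto simp: eigenvector_def smult_smult_assoc smult_mat_mult_vec)
    then show "y \<in> eigenvalues (x \<cdot>\<^sub>m A)"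
      using v by (auto simp: eigenvalues_def eigenvalue_def eigenvector_def)
  qed
  moreover have "card ((*) x ` eigenvalues A) = n"
    using assms by (subst card_image) (auto simp: inj_on_def)
  moreover have xA: "x \<cdot>\<^sub>m A \<in> carrier_mat n n" using A by simp
  ultimately have "n \<le> card (eigenvalues (x \<cdot>\<^sub>m A))"
    using card_mono[OF finite_eigenvalues[OF xA], of "(*) x ` eigenvalues A"] by simp
  then show ?thesis using card_eigenvalues_le[OF xA] by simp
qed

definition pad_mat :: "nat \<Rightarrow> 'a::zero mat \<Rightarrow> 'a mat"
  where "pad_mat N A = mat (Suc N) (Suc N) (\<lambda>(p, q). if p < N \<and> q < N then A $$ (p, q) else 0)"

lemma pad_mat_carrier [simp]: "pad_mat N A \<in> carrier_mat (Suc N) (Suc N)"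
  by (simp add: pad_mat_def)

text \<open>Products respect the padding. Only the empty word, the identity matrix, puts a nonzero
  entry into the new corner, so it must be absent in \<open>words_eval_pad\<close>.\<close>

lemma word_mat_pad:
  fixes a :: "nat \<Rightarrow> 'a::semiring_1 mat"
  assumes a: "\<And>i. a i \<in> carrier_mat N N" and pq: "p < Suc N" "q < Suc N"
  shows "word_mat (Suc N) (\<lambda>i. pad_mat N (a i)) w $$ (p, q) =
    (if p < N \<and> q < N then word_mat N a w $$ (p, q) else if p = q \<and> w = [] then 1 else 0)"
  using pq
proof (induction w arbitrary: p q)
  case (Cons i w)
  let ?B = "word_mat (Suc N) (\<lambda>i. pad_mat N (a i)) w"
  have B: "?B \<in> carrier_mat (Suc N) (Suc N)" by (rule word_mat_carrier) simp
  have C: "word_mat N a w \<in> carrier_mat N N" by (rule word_mat_carrier) (rule a)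
  have "word_mat (Suc N) (\<lambda>i. pad_mat N (a i)) (i # w) $$ (p, q) =
      (\<Sum>k = 0..<Suc N. (if p < N \<and> k < N then a i $$ (p, k) else 0) * ?B $$ (k, q))"
    using B Cons.prems by (auto simp: pad_mat_def scalar_prod_def simp del: sum.op_ivl_Suc intro!: sum.cong)
  also have "\<dots> = (\<Sum>k = 0..<N. (if p < N then a i $$ (p, k) else 0) * ?B $$ (k, q))"
    by simp
  also have "\<dots> = (\<Sum>k = 0..<N. if p < N \<and> q < N then a i $$ (p, k) * word_mat N a w $$ (k, q) else 0)"
    using Cons by (intro sum.cong) auto
  also have "\<dots> = (if p < N \<and> q < N then word_mat N a (i # w) $$ (p, q) else 0)"
    using a[of i] C by (auto simp: scalar_prod_def intro!: sum.cong)
  finally show ?case by simp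
qed auto

lemma words_eval_pad:
  fixes a :: "nat \<Rightarrow> 'a::semiring_1 mat"
  assumes "\<And>i. a i \<in> carrier_mat N N" and "[] \<notin> W"
  shows "words_eval (Suc N) W c (\<lambda>i. pad_mat N (a i)) = pad_mat N (words_eval N W c a)"
proof (rule eq_matI)
  fix p q assume "p < dim_row (pad_mat N (words_eval N W c a))" "q < dim_col (pad_mat N (words_eval N W c a))"
  then have pq: "p < Suc N" "q < Suc N" by (auto simp: pad_mat_def)
  have "words_eval (Suc N) W c (\<lambda>i. pad_mat N (a i)) $$ (p, q) =
      (\<Sum>w\<in>W. if p < N \<and> q < N then c w * word_mat N a w $$ (p, q) else 0)"
    unfolding words_eval_index[OF pq]
    using assms by (intro sum.cong) (auto simp: word_mat_pad[OF assms(1) pq])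
  also have "\<dots> = pad_mat N (words_eval N W c a) $$ (p, q)"
    using pq by (auto simp: pad_mat_def words_eval_index)
  finally show "words_eval (Suc N) W c (\<lambda>i. pad_mat N (a i)) $$ (p, q) =
      pad_mat N (words_eval N W c a) $$ (p, q)" .
qed (auto simp: pad_mat_def words_eval_def)

lemma pad_mat_mult_vec:
  fixes A :: "'a::semiring_1 mat"
  assumes "A \<in> carrier_mat N N" "v \<in> carrier_vec (Suc N)" "p < Suc N"
  shows "(pad_mat N A *\<^sub>v v) $ p = (if p < N then \<Sum>k = 0..<N. A $$ (p, k) * v $ k else 0)"
  using assms by (auto simp: pad_mat_def scalar_prod_def intro!: sum.cong)

text \<open>Eigenvectors extend by zero, and the last unit vector contributes the eigenvalue 0,
  which is new because \<open>A\<close> is invertible.\<close>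

lemma card_eigenvalues_pad:
  fixes A :: "'a::field mat"
  assumes A: "A \<in> carrier_mat N N" and card: "card (eigenvalues A) = N" and det: "det A \<noteq> 0"
  shows "card (eigenvalues (pad_mat N A)) = Suc N"
proof -
  have P: "pad_mat N A \<in> carrier_mat (Suc N) (Suc N)" by simp
  have "k \<in> eigenvalues (pad_mat N A)" if "k \<in> eigenvalues A" for k
  proof -
    from that obtain v where v: "v \<in> carrier_vec N" "v \<noteq> 0\<^sub>v N" "A *\<^sub>v v = k \<cdot>\<^sub>v v"
      using A by (auto simp: eigenvalues_def eigenvalue_def eigenvector_def)
    define u where "u = vec (Suc N) (\<lambda>p. if p < N then v $ p else 0)"
    have "pad_mat N A *\<^sub>v u = k \<cdot>\<^sub>v u"
    proof (rule eq_vecI)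
      fix p assume "p < dim_vec (k \<cdot>\<^sub>v u)"
      then have p: "p < Suc N" by (simp add: u_def)
      have "(A *\<^sub>v v) $ p = k * v $ p" if "p < N" using v that by simp
      then have "(\<Sum>j = 0..<N. A $$ (p, j) * v $ j) = k * v $ p" if "p < N"
        using v(1) A that by (simp add: scalar_prod_def)
      then show "(pad_mat N A *\<^sub>v u) $ p = (k \<cdot>\<^sub>v u) $ p"
        using p pad_mat_mult_vec[OF A _ p, of u] by (simp add: u_def)
    qed (simp add: u_def pad_mat_def)
    moreover have "u \<noteq> 0\<^sub>v (Suc N)"
    proof
      assume u: "u = 0\<^sub>v (Suc N)"
      have "v $ p = 0" if "p < N" for p
        using arg_cong[OF u, of "\<lambda>w. w $ p"] that by (simp add: u_def)
      then have "v = 0\<^sub>v N" using v(1) by (intro eq_vecI) auto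
      with v show False by simp
    qed
    ultimately show ?thesis
      by (auto simp: eigenvalues_def eigenvalue_def eigenvector_def u_def pad_mat_def intro!: exI[of _ u])
  qed
  moreover have "0 \<in> eigenvalues (pad_mat N A)"
  proof -
    let ?e = "unit_vec (Suc N) N"
    have "pad_mat N A *\<^sub>v ?e = 0 \<cdot>\<^sub>v ?e"
    proof (rule eq_vecI)
      fix p assume "p < dim_vec (0 \<cdot>\<^sub>v ?e :: 'a vec)"
      then have p: "p < Suc N" by simp
      then show "(pad_mat N A *\<^sub>v ?e) $ p = (0 \<cdot>\<^sub>v ?e) $ p"
        using pad_mat_mult_vec[OF A unit_vec_carrier p] by simp
    qed (simp add: pad_mat_def)
    moreover have "?e \<noteq> (0\<^sub>v (Suc N) :: 'a vec)"
      using arg_cong[of ?e "0\<^sub>v (Suc N) :: 'a vec" "\<lambda>w. w $ N"] by auto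
    ultimately show ?thesis
      by (auto simp: eigenvalues_def eigenvalue_def eigenvector_def pad_mat_def intro!: exI[of _ ?e])
  qed
  ultimately have "insert 0 (eigenvalues A) \<subseteq> eigenvalues (pad_mat N A)" by auto
  then have "card (insert 0 (eigenvalues A)) \<le> card (eigenvalues (pad_mat N A))"
    by (intro card_mono finite_eigenvalues[OF P])
  moreover have "0 \<notin> eigenvalues A"
  proof
    assume "0 \<in> eigenvalues A"
    then obtain v where v: "v \<in> carrier_vec N" "v \<noteq> 0\<^sub>v N" "A *\<^sub>v v = 0 \<cdot>\<^sub>v v"
      using A by (auto simp: eigenvalues_def eigenvalue_def eigenvector_def)
    then have "A *\<^sub>v v = 0\<^sub>v N" by auto
    with v det show False using det_0_iff_vec_prod_zero_field[OF A] by blast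
  qed
  ultimately show ?thesis
    using card finite_eigenvalues[OF A] card_eigenvalues_le[OF P] by simp
qed

text \<open>The length bound puts the critical index \<open>r\<close>, at most half the length of
  \<open>w\<close>, below \<open>n\<close>. Size \<open>r + 1\<close> starts an induction that pads
  up to size \<open>n\<close>.\<close>

lemma ex_simple_spectrum:
  fixes c :: "nat list \<Rightarrow> 'a::{alg_closed_field, field_char_0}"
  assumes W: "finite W" "[] \<notin> W" and w: "w \<in> W" "c w \<noteq> 0" and len: "length w < 2 * n"
  shows "\<exists>a. (\<forall>i. a i \<in> carrier_mat n n) \<and> card (eigenvalues (words_eval n W c a)) = n"
proof -
  let ?nonzero = "\<lambda>d. \<exists>s t. walk_sum W c s t 0 d \<noteq> 0"
  define r where "r = (LEAST d. ?nonzero d)"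
  have half: "?nonzero (length w div 2)"
    by (rule walk_sum_nonzero[of W w c, OF W(1) w]) presburger
  have "?nonzero r" unfolding r_def by (rule LeastI[of ?nonzero, OF half])
  have "r \<le> length w div 2" unfolding r_def by (rule Least_le[of ?nonzero, OF half])
  then have rn: "r < n" using len by linarith
  \<comment> \<open>Minimality concerns walks from 0; shifting the weights carries it to every
    start.\<close>
  have zero: "walk_sum W c s t p d = 0" if "d < r" for s t p d
    using not_less_Least[of d ?nonzero] that walk_sum_shift[of W c s p t 0 d]
    by (auto simp: r_def)
  have family: "\<exists>M b. M \<in> carrier_mat N N \<and> (\<forall>p<N. b p \<noteq> 0)
      \<and> map_mat (\<lambda>p. poly p 0) M = weighted_shift N r b
      \<and> (\<forall>x. \<exists>a. (\<forall>i. a i \<in> carrier_mat N N) \<and> words_eval N W c a = x ^ r \<cdot>\<^sub>m map_mat (\<lambda>p. poly p x) M)"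
    if N: "r < N" for N
  proof -
    from \<open>?nonzero r\<close> obtain s\<^sub>0 t\<^sub>0 where "walk_sum W c s\<^sub>0 t\<^sub>0 0 r \<noteq> 0" by blast
    from walk_sum_nonzero_everywhere[OF this N] obtain s t
      where st: "\<And>q. s (q mod N) = s q" "\<And>q. t (q mod N) = t q"
        "\<And>p. p < N \<Longrightarrow> walk_sum W c s t p r \<noteq> 0" by auto
    obtain M where M: "M \<in> carrier_mat N N"
      "map_mat (\<lambda>p. poly p 0) M = weighted_shift N r (\<lambda>p. walk_sum W c s t p r)"
      "\<And>x. words_eval N W c (cyclic_mat N s t x) = x ^ r \<cdot>\<^sub>m map_mat (\<lambda>p. poly p x) M"
      using words_eval_cyclic[of W s N t r c, OF W(1) st(1,2) zero] by blast
    show ?thesis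
    proof (intro exI conjI allI)
      show "words_eval N W c (cyclic_mat N s t x) = x ^ r \<cdot>\<^sub>m map_mat (\<lambda>p. poly p x) M" for x
        by (rule M)
    qed (use M st in auto)
  qed
  have det: "\<exists>a. (\<forall>i. a i \<in> carrier_mat N N) \<and> det (words_eval N W c a) \<noteq> 0" if N: "r < N" for N
  proof -
    from family[OF N] obtain M b where M: "M \<in> carrier_mat N N" and b: "\<And>p. p < N \<Longrightarrow> b p \<noteq> 0"
      and M0: "map_mat (\<lambda>p. poly p 0) M = weighted_shift N r b"
      and ev: "\<And>x. \<exists>a. (\<forall>i. a i \<in> carrier_mat N N) \<and> words_eval N W c a = x ^ r \<cdot>\<^sub>m map_mat (\<lambda>p. poly p x) M"
      by auto
    have "det (map_mat (\<lambda>p. poly p 0) M) \<noteq> 0" using det_weighted_shift[OF b N] M0 by simp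
    \<comment> \<open>Besides the singular parameters, \<open>x = 0\<close> is excluded because the
      value carries the factor \<open>x ^ r\<close>.\<close>
    then have "finite (insert 0 {y. det (map_mat (\<lambda>p. poly p y) M) = 0})"
      using finite_det_zero by blast
    from ex_new_if_finite[OF infinite_UNIV_char_0 this]
    obtain x where x: "x \<noteq> 0" "det (map_mat (\<lambda>p. poly p x) M) \<noteq> 0" by auto
    obtain a where "\<forall>i. a i \<in> carrier_mat N N" "words_eval N W c a = x ^ r \<cdot>\<^sub>m map_mat (\<lambda>p. poly p x) M"
      using ev by blast
    then show ?thesis using x by (intro exI[of _ a]) (simp add: det_smult)
  qed
  have minimal: "\<exists>a. (\<forall>i. a i \<in> carrier_mat (Suc r) (Suc r)) \<and> card (eigenvalues (words_eval (Suc r) W c a)) = Suc r"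
  proof -
    from family[OF lessI] obtain M b where M: "M \<in> carrier_mat (Suc r) (Suc r)"
      and b: "\<And>p. p \<le> r \<Longrightarrow> b p \<noteq> 0"
      and M0: "map_mat (\<lambda>p. poly p 0) M = weighted_shift (Suc r) r b"
      and ev: "\<And>x. \<exists>a. (\<forall>i. a i \<in> carrier_mat (Suc r) (Suc r))
        \<and> words_eval (Suc r) W c a = x ^ r \<cdot>\<^sub>m map_mat (\<lambda>p. poly p x) M"
      by (auto simp: less_Suc_eq_le)
    have "card (eigenvalues (map_mat (\<lambda>p. poly p 0) M)) = Suc r"
      using weighted_cycle_simple_spectrum[of r b, OF b] M0 by simp
    from finite_nonsimple_spectrum[OF M this]
    have "finite (insert 0 {y. card (eigenvalues (map_mat (\<lambda>p. poly p y) M)) \<noteq> Suc r})" by simp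
    from ex_new_if_finite[OF infinite_UNIV_char_0 this]
    obtain x where x: "x \<noteq> 0" "card (eigenvalues (map_mat (\<lambda>p. poly p x) M)) = Suc r" by auto
    obtain a where a: "\<forall>i. a i \<in> carrier_mat (Suc r) (Suc r)"
      "words_eval (Suc r) W c a = x ^ r \<cdot>\<^sub>m map_mat (\<lambda>p. poly p x) M"
      using ev by blast
    have "map_mat (\<lambda>p. poly p x) M \<in> carrier_mat (Suc r) (Suc r)" using M by simp
    from card_eigenvalues_smult[OF this x(2), of "x ^ r"] a x(1)
    show ?thesis by (intro exI[of _ a]) simp
  qed
  from rn have "Suc r \<le> n" by simp
  then show ?thesis
  proof (induction n rule: dec_induct)
    case base
    show ?case by (rule minimal)
  next
    case (step N)
    then obtain a where a: "\<And>i. a i \<in> carrier_mat N N" "card (eigenvalues (words_eval N W c a)) = N"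
      by auto
    obtain a' where a': "\<And>i. a' i \<in> carrier_mat N N" "det (words_eval N W c a') \<noteq> 0"
      using det[of N] step by auto
    \<comment> \<open>The line from \<open>a\<close>, with simple spectrum, at 0 to
      \<open>a'\<close>, with invertible value, at 1. All but finitely many of its points have both
      properties.\<close>
    define l where "l = (\<lambda>i. mat N N (\<lambda>(p, q). [:a i $$ (p, q), a' i $$ (p, q) - a i $$ (p, q):]))"
    define M where "M = words_eval N W (\<lambda>w. [:c w:]) l"
    have l: "l i \<in> carrier_mat N N" for i by (simp add: l_def)
    have M: "map_mat (\<lambda>p. poly p x) M = words_eval N W c (\<lambda>i. map_mat (\<lambda>p. poly p x) (l i))" for x
      unfolding M_def by (rule poly_words_eval[OF l])
    have l0: "(\<lambda>i. map_mat (\<lambda>p. poly p 0) (l i)) = a"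
    proof
      fix i show "map_mat (\<lambda>p. poly p 0) (l i) = a i"
        using a(1)[of i] by (intro eq_matI) (auto simp: l_def)
    qed
    have l1: "(\<lambda>i. map_mat (\<lambda>p. poly p 1) (l i)) = a'"
    proof
      fix i show "map_mat (\<lambda>p. poly p 1) (l i) = a' i"
        using a'(1)[of i] by (intro eq_matI) (auto simp: l_def)
    qed
    have "M \<in> carrier_mat N N" by (simp add: M_def)
    then have "finite {y. card (eigenvalues (map_mat (\<lambda>p. poly p y) M)) \<noteq> N}"
      by (rule finite_nonsimple_spectrum[where x = 0]) (simp add: M l0 a)
    moreover have "finite {y. det (map_mat (\<lambda>p. poly p y) M) = 0}"
      by (rule finite_det_zero[where x = 1]) (simp add: M l1 a')
    ultimately have "finite ({y. card (eigenvalues (map_mat (\<lambda>p. poly p y) M)) \<noteq> N} \<union>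
        {y. det (map_mat (\<lambda>p. poly p y) M) = 0})" by simp
    from ex_new_if_finite[OF infinite_UNIV_char_0 this]
    obtain x where x: "card (eigenvalues (map_mat (\<lambda>p. poly p x) M)) = N"
      "det (map_mat (\<lambda>p. poly p x) M) \<noteq> 0" by auto
    define a'' where "a'' = (\<lambda>i. map_mat (\<lambda>p. poly p x) (l i))"
    have a'': "a'' i \<in> carrier_mat N N" for i using l[of i] by (simp add: a''_def)
    have "card (eigenvalues (words_eval (Suc N) W c (\<lambda>i. pad_mat N (a'' i)))) = Suc N"
      unfolding words_eval_pad[OF a'' W(2)]
      using x by (intro card_eigenvalues_pad) (simp_all add: M a''_def)
    then show ?case by (intro exI[of _ "\<lambda>i. pad_mat N (a'' i)"]) simp
  qed
qed

section \<open>Trace zero matrices\<close>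

text \<open>Induction on the number of nonzero diagonal entries: an elementary conjugation moves one
  such entry onto another, given a nonzero off-diagonal entry joining them.\<close>

lemma similar_zero_diagonal:
  fixes A :: "'a::field_char_0 mat"
  assumes "A \<in> carrier_mat n n" and "(\<Sum>i<n. A $$ (i, i)) = 0"
  shows "\<exists>Z \<in> carrier_mat n n. similar_mat A Z \<and> (\<forall>i<n. Z $$ (i, i) = 0)"
  using assms
proof (induction "card {i. i < n \<and> A $$ (i, i) \<noteq> 0}" arbitrary: A rule: less_induct)
  case less
  note A = less.prems(1) and trace = less.prems(2)
  let ?nz = "\<lambda>A. {i. i < n \<and> A $$ (i, i) \<noteq> (0 :: 'a)}"
  have diag: "add_col_sub_row x k l B $$ (i, i) =
      (if i = k then B $$ (i, i) - x * B $$ (l, k) else if i = l then B $$ (i, i) + x * B $$ (l, k) else B $$ (i, i))"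
    if "B \<in> carrier_mat n n" "k < n" "l < n" "k \<noteq> l" "i < n" for B :: "'a mat" and x k l i
    using that by auto
  have reduce: "\<exists>Z \<in> carrier_mat n n. similar_mat A Z \<and> (\<forall>i<n. Z $$ (i, i) = 0)"
    if B: "B \<in> carrier_mat n n" "similar_mat A B" "\<And>i. i < n \<Longrightarrow> B $$ (i, i) = A $$ (i, i)"
      and kl: "k < n" "l < n" "k \<noteq> l" "B $$ (l, k) \<noteq> 0" "A $$ (k, k) \<noteq> 0" "A $$ (l, l) \<noteq> 0"
    for B k l
  proof -
    \<comment> \<open>The factor makes diagonal entry \<open>k\<close> vanish and moves its value to
      entry \<open>l\<close>, which was already nonzero, so the count drops.\<close>
    define C where "C = add_col_sub_row (B $$ (k, k) / B $$ (l, k)) k l B"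
    have C: "C \<in> carrier_mat n n" using B by (simp add: C_def)
    have sim: "similar_mat A C"
      using similar_mat_trans[OF B(2) similar_mat_sym[OF add_col_sub_row_similar[OF B(1) kl(1-3)]]]
      by (simp add: C_def)
    have Cd: "C $$ (i, i) = (if i = k then 0 else if i = l then A $$ (l, l) + A $$ (k, k) else A $$ (i, i))"
      if "i < n" for i
      using diag[OF B(1) kl(1-3) that] kl B(3)[OF kl(1)] B(3)[OF kl(2)] B(3)[OF that] by (simp add: C_def)
    have "(\<Sum>i<n. C $$ (i, i)) = (\<Sum>i<n. A $$ (i, i) + (if i = l then A $$ (k, k) else 0) - (if i = k then A $$ (k, k) else 0))"
      using kl by (intro sum.cong) (auto simp: Cd)
    also have "\<dots> = 0" using kl trace by (simp add: sum.distrib sum_subtractf)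
    finally have trC: "(\<Sum>i<n. C $$ (i, i)) = 0" .
    have "?nz C \<subset> ?nz A"
    proof
      show "?nz C \<subseteq> ?nz A" using kl by (auto simp: Cd split: if_splits)
      have "k \<in> ?nz A" "k \<notin> ?nz C" using kl by (auto simp: Cd)
      then show "?nz C \<noteq> ?nz A" by blast
    qed
    then have "card (?nz C) < card (?nz A)" by (intro psubset_card_mono) auto
    from less.hyps[OF this C trC] obtain Z where "Z \<in> carrier_mat n n" "similar_mat C Z" "\<forall>i<n. Z $$ (i, i) = 0"
      by blast
    then show ?thesis using similar_mat_trans[OF sim] by blast
  qed
  show ?case
  proof (cases "?nz A = {}")
    case True
    then show ?thesis using A similar_mat_refl[OF A] by blast
  next
    case False
    then obtain i where i: "i < n" "A $$ (i, i) \<noteq> 0" by blast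
    \<comment> \<open>If all nonzero diagonal entries agreed, the trace would be a positive integer
      multiple of one of them, which is nonzero in characteristic 0.\<close>
    have "\<exists>j \<in> ?nz A. A $$ (j, j) \<noteq> A $$ (i, i)"
    proof (rule ccontr)
      assume "\<not> ?thesis"
      then have eq: "A $$ (j, j) = A $$ (i, i)" if "j \<in> ?nz A" for j using that by blast
      have "(\<Sum>j<n. A $$ (j, j)) = (\<Sum>j\<in>?nz A. A $$ (j, j))"
        by (intro sum.mono_neutral_right) auto
      also have "\<dots> = (\<Sum>j\<in>?nz A. A $$ (i, i))"
        by (rule sum.cong[OF refl eq])
      also have "\<dots> = of_nat (card (?nz A)) * A $$ (i, i)" by simp
      finally have "card (?nz A) = 0" using trace i by simp
      then show False using i by auto
    qed
    then obtain j where j: "j < n" "A $$ (j, j) \<noteq> 0" "A $$ (j, j) \<noteq> A $$ (i, i)" by blast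
    then have "i \<noteq> j" by blast
    consider "A $$ (j, i) \<noteq> 0" | "A $$ (i, j) \<noteq> 0" | "A $$ (j, i) = 0" "A $$ (i, j) = 0" by blast
    then show ?thesis
    proof cases
      case 1
      show ?thesis
        by (rule reduce[OF A similar_mat_refl[OF A], of i j]) (use i j 1 \<open>i \<noteq> j\<close> in auto)
    next
      case 2
      show ?thesis
        by (rule reduce[OF A similar_mat_refl[OF A], of j i]) (use i j 2 \<open>i \<noteq> j\<close> in auto)
    next
      case 3
      \<comment> \<open>This conjugation keeps the diagonal, and its entry at \<open>(i, j)\<close>
        is, up to sign, the nonzero difference of the two diagonal entries.\<close>
      let ?B = "add_col_sub_row 1 i j A"
      have B: "?B \<in> carrier_mat n n" using A by simp
      have sim: "similar_mat A ?B"
        by (rule similar_mat_sym[OF add_col_sub_row_similar[OF A i(1) j(1) \<open>i \<noteq> j\<close>]])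
      have "?B $$ (k, k) = A $$ (k, k)" if "k < n" for k
        using diag[OF A i(1) j(1) \<open>i \<noteq> j\<close> that] 3 by simp
      moreover have "?B $$ (i, j) \<noteq> 0"
        using A i j 3 \<open>i \<noteq> j\<close> by simp
      ultimately show ?thesis
        by (intro reduce[OF B sim, of j i]) (use i j \<open>i \<noteq> j\<close> in auto)
    qed
  qed
qed

text \<open>The diagonal entries of a triangular matrix are its eigenvalues; the lower triangular
  case passes to the transpose, which has the same characteristic polynomial.\<close>

lemma similar_triangular:
  fixes A :: "'a::field mat"
  assumes A: "A \<in> carrier_mat n n" "upper_triangular A \<or> upper_triangular (transpose_mat A)"
    and inj: "inj_on l {..<n}" and diag: "\<And>i. i < n \<Longrightarrow> A $$ (i, i) = l i"
  shows "similar_mat A (diag_of n l)"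
proof (rule similar_diag_of[OF A(1) inj])
  fix i assume i: "i < n"
  have cp: "poly (char_poly B) (l i) = 0"
    if B: "B \<in> carrier_mat n n" "upper_triangular B" "\<And>i. i < n \<Longrightarrow> B $$ (i, i) = l i" for B
  proof -
    have "l i \<in> set (diag_mat B)" using B i by (auto simp: diag_mat_def)
    then show ?thesis
      unfolding char_poly_upper_triangular[OF B(1,2)] poly_prod_list
      by (auto simp: prod_list_zero_iff image_iff intro!: bexI[of _ "l i"])
  qed
  have "poly (char_poly A) (l i) = 0"
    using A(2)
  proof
    assume "upper_triangular A"
    then show ?thesis using cp[OF A(1)] diag by blast
  next
    assume "upper_triangular (transpose_mat A)"
    then have "poly (char_poly (transpose_mat A)) (l i) = 0"
      using A(1) diag by (intro cp) auto
    then show ?thesis using A(1) by simp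
  qed
  then show "eigenvalue A (l i)" by (simp add: eigenvalue_root_char_poly[OF A(1)])
qed

section \<open>Conjugation invariance, and passage from noncommutative polynomials to words\<close>

lemma word_mat_conj:
  fixes a :: "nat \<Rightarrow> 'a::semiring_1 mat"
  assumes a: "\<And>i. a i \<in> carrier_mat n n" and P: "P \<in> carrier_mat n n" and Q: "Q \<in> carrier_mat n n"
    and PQ: "P * Q = 1\<^sub>m n" "Q * P = 1\<^sub>m n"
  shows "word_mat n (\<lambda>i. P * a i * Q) w = P * word_mat n a w * Q"
proof (induction w)
  case Nil
  show ?case using P Q PQ by simp
next
  case (Cons i w)
  let ?B = "word_mat n a w"
  have B: "?B \<in> carrier_mat n n" by (rule word_mat_carrier) (rule a)
  have "P * a i * Q * (P * ?B * Q) = P * a i * (Q * (P * ?B * Q))"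
    using P Q a[of i] B by (intro assoc_mult_mat[of _ n n _ n _ n]) auto
  also have "Q * (P * ?B * Q) = Q * P * ?B * Q"
    using P Q B by (simp add: assoc_mult_mat[of _ n n _ n _ n])
  also have "\<dots> = ?B * Q" using PQ B by simp
  also have "P * a i * (?B * Q) = P * (a i * ?B) * Q"
    using P Q a[of i] B by (simp add: assoc_mult_mat[of _ n n _ n _ n])
  finally show ?case using Cons by simp
qed

lemma words_eval_conj:
  fixes a :: "nat \<Rightarrow> 'a::comm_semiring_1 mat"
  assumes a: "\<And>i. a i \<in> carrier_mat n n" and P: "P \<in> carrier_mat n n" and Q: "Q \<in> carrier_mat n n"
    and PQ: "P * Q = 1\<^sub>m n" "Q * P = 1\<^sub>m n"
  shows "words_eval n W c (\<lambda>i. P * a i * Q) = P * words_eval n W c a * Q"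
proof (rule eq_matI)
  have entry: "(P * B * Q) $$ (p, q) = (\<Sum>l = 0..<n. (\<Sum>k = 0..<n. P $$ (p, k) * B $$ (k, l)) * Q $$ (l, q))"
    if "B \<in> carrier_mat n n" "p < n" "q < n" for B p q
    using that P Q by (simp add: scalar_prod_def del: assoc_mult_mat)
  fix p q assume "p < dim_row (P * words_eval n W c a * Q)" "q < dim_col (P * words_eval n W c a * Q)"
  then have pq: "p < n" "q < n" using P Q by auto
  have C: "word_mat n a w \<in> carrier_mat n n" for w by (rule word_mat_carrier) (rule a)
  have "words_eval n W c (\<lambda>i. P * a i * Q) $$ (p, q) =
      (\<Sum>w\<in>W. c w * (\<Sum>l = 0..<n. (\<Sum>k = 0..<n. P $$ (p, k) * word_mat n a w $$ (k, l)) * Q $$ (l, q)))"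
    by (simp add: words_eval_index[OF pq] word_mat_conj[OF assms] entry[OF C pq])
  also have "\<dots> = (\<Sum>l = 0..<n. \<Sum>w\<in>W. \<Sum>k = 0..<n. c w * (P $$ (p, k) * word_mat n a w $$ (k, l) * Q $$ (l, q)))"
    unfolding sum_distrib_left sum_distrib_right by (rule sum.swap)
  also have "\<dots> = (\<Sum>l = 0..<n. \<Sum>k = 0..<n. \<Sum>w\<in>W. c w * (P $$ (p, k) * word_mat n a w $$ (k, l) * Q $$ (l, q)))"
    by (intro sum.cong refl sum.swap)
  also have "\<dots> = (\<Sum>l = 0..<n. (\<Sum>k = 0..<n. P $$ (p, k) * words_eval n W c a $$ (k, l)) * Q $$ (l, q))"
    unfolding sum_distrib_right
    by (intro sum.cong refl) (simp add: words_eval_index sum_distrib_left sum_distrib_right mult_ac)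
  also have "\<dots> = (P * words_eval n W c a * Q) $$ (p, q)"
    by (rule entry[OF words_eval_carrier pq, symmetric])
  finally show "words_eval n W c (\<lambda>i. P * a i * Q) $$ (p, q) = (P * words_eval n W c a * Q) $$ (p, q)" .
qed (use P Q in \<open>auto simp: words_eval_def\<close>)

lemma finsum_ring_mat_index:
  fixes F :: "'b \<Rightarrow> 'a::semiring_1 mat"
  assumes "finite K" "\<And>k. k \<in> K \<Longrightarrow> F k \<in> carrier_mat n n"
  shows "finsum (ring_mat TYPE('a) n ()) F K = mat n n (\<lambda>(p, q). \<Sum>k\<in>K. F k $$ (p, q))"
proof -
  interpret semiring "ring_mat TYPE('a) n ()" by (rule semiring_mat)
  from assms show ?thesis
  proof (induction K rule: finite_induct)
    case empty
    show ?case by (intro eq_matI) (simp_all add: ring_mat_simps)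
  next
    case (insert k K)
    then have "finsum (ring_mat TYPE('a) n ()) F (insert k K) =
        F k + finsum (ring_mat TYPE('a) n ()) F K"
      by (subst finsum_insert) (auto simp: ring_mat_simps)
    also have "\<dots> = mat n n (\<lambda>(p, q). \<Sum>k\<in>insert k K. F k $$ (p, q))"
      using insert by (intro eq_matI) auto
    finally show ?case .
  qed
qed

lemma ncpoly_eval_words:
  fixes f :: "'a::comm_ring_1 ncpoly"
  assumes a: "\<And>i. a i \<in> carrier_mat n n"
  shows "ncpoly_eval n f a =
    words_eval n (letters ` Poly_Mapping.keys f) (\<lambda>w. Poly_Mapping.lookup f (Word w)) a"
proof -
  let ?F = "\<lambda>w. Poly_Mapping.lookup f w \<cdot>\<^sub>m word_eval n a w"
  have we: "word_eval n a w = word_mat n a (letters w)" for w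
    by (simp add: word_eval_def word_mat_def)
  have C: "word_eval n a w \<in> carrier_mat n n" for w
    unfolding we by (rule word_mat_carrier) (rule a)
  then have dim: "dim_row (word_mat n a (letters w)) = n" "dim_col (word_mat n a (letters w)) = n" for w
    by (metis we carrier_matD)+
  have "inj_on letters (Poly_Mapping.keys f)" by (intro inj_onI) (metis ncword.collapse)
  then show ?thesis
    unfolding ncpoly_eval_def
    using C by (subst finsum_ring_mat_index)
      (auto simp: words_eval_def sum.reindex we dim intro!: eq_matI sum.cong)
qed

text \<open>Used to restore the constant term of the polynomial, which merely translates the
  spectrum.\<close>

lemma card_eigenvalues_add_scalar:
  fixes A :: "'a::field mat"
  assumes A: "A \<in> carrier_mat n n" and "card (eigenvalues A) = n"
  shows "card (eigenvalues (A + x \<cdot>\<^sub>m 1\<^sub>m n)) = n"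
proof -
  let ?B = "A + x \<cdot>\<^sub>m 1\<^sub>m n"
  have B: "?B \<in> carrier_mat n n" using A by simp
  have "(+) x ` eigenvalues A \<subseteq> eigenvalues ?B"
  proof
    fix y assume "y \<in> (+) x ` eigenvalues A"
    then obtain k v where y: "y = x + k" and v: "v \<in> carrier_vec n" "v \<noteq> 0\<^sub>v n" "A *\<^sub>v v = k \<cdot>\<^sub>v v"
      using A by (auto simp: eigenvalues_def eigenvalue_def eigenvector_def)
    have "?B *\<^sub>v v = A *\<^sub>v v + (x \<cdot>\<^sub>m 1\<^sub>m n) *\<^sub>v v"
      using A v(1) by (intro add_mult_distrib_mat_vec) auto
    also have "\<dots> = k \<cdot>\<^sub>v v + x \<cdot>\<^sub>v v"
      using v by (simp add: smult_mat_mult_vec[of _ n n])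
    also have "\<dots> = y \<cdot>\<^sub>v v"
      using v(1) by (intro eq_vecI) (auto simp: y algebra_simps)
    finally show "y \<in> eigenvalues ?B"
      using v A by (auto simp: eigenvalues_def eigenvalue_def eigenvector_def intro!: exI[of _ v])
  qed
  then have "n \<le> card (eigenvalues ?B)"
    using card_mono[OF finite_eigenvalues[OF B], of "(+) x ` eigenvalues A"] assms(2)
    by (simp add: card_image)
  then show ?thesis using card_eigenvalues_le[OF B] by simp
qed

lemma ncpoly_image_carrier:
  fixes f :: "'a::comm_ring_1 ncpoly"
  shows "A \<in> ncpoly_image n f \<Longrightarrow> A \<in> carrier_mat n n"
  by (auto simp: ncpoly_image_def ncpoly_eval_words)

text \<open>Conjugating all arguments conjugates the value.\<close>

lemma ncpoly_image_similar:
  fixes f :: "'a::comm_ring_1 ncpoly"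
  assumes A: "A \<in> ncpoly_image n f" and sim: "similar_mat B A"
  shows "B \<in> ncpoly_image n f"
proof -
  obtain a where a: "\<And>i. a i \<in> carrier_mat n n" and A_eq: "A = ncpoly_eval n f a"
    using A by (auto simp: ncpoly_image_def)
  obtain P Q where wit: "similar_mat_wit A B Q P"
    using similar_mat_sym[OF sim] by (auto simp: similar_mat_def)
  note PQ = similar_mat_witD2[OF ncpoly_image_carrier[OF A] wit]
  have PaQ: "P * a i * Q \<in> carrier_mat n n" for i using PQ a[of i] by auto
  have "B = P * A * Q" using similar_mat_witD[OF refl similar_mat_wit_sym[OF wit]] by blast
  also have "\<dots> = ncpoly_eval n f (\<lambda>i. P * a i * Q)"
    unfolding A_eq ncpoly_eval_words[OF a] ncpoly_eval_words[OF PaQ]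
    by (rule words_eval_conj[OF a, symmetric]) (use PQ in auto)
  finally show ?thesis using PaQ by (auto simp: ncpoly_image_def)
qed

lemma ncpoly_image_simple_spectrum:
  fixes f :: "'a::{alg_closed_field, field_char_0} ncpoly"
  assumes "ncpoly_degree f \<ge> 1" "ncpoly_degree f < 2 * n"
  shows "\<exists>A \<in> ncpoly_image n f. card (eigenvalues A) = n"
proof -
  let ?K = "Poly_Mapping.keys f"
  define c where "c = (\<lambda>w. Poly_Mapping.lookup f (Word w))"
  define W where "W = letters ` ?K - {[]}"
  \<comment> \<open>The maximum is attained, and since it is at least 1 it comes from an actual word
    rather than from the inserted 0.\<close>
  have "ncpoly_degree f \<in> insert 0 ((\<lambda>w. length (letters w)) ` ?K)"
    unfolding ncpoly_degree_def by (rule Max_in) auto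
  then obtain v where v: "v \<in> ?K" "length (letters v) = ncpoly_degree f" using assms by auto
  have "letters v \<in> W" using v assms by (auto simp: W_def)
  moreover have "c (letters v) \<noteq> 0" using v by (simp add: c_def in_keys_iff)
  ultimately obtain a where a: "\<And>i. a i \<in> carrier_mat n n"
    and simple: "card (eigenvalues (words_eval n W c a)) = n"
    using ex_simple_spectrum[of W "letters v" c n] v assms by (auto simp: W_def)
  \<comment> \<open>Coefficients outside the support are 0, so the constant term can be split off
    whether or not the empty word occurs.\<close>
  have c0: "c [] = 0" if "[] \<notin> letters ` ?K"
  proof -
    have "Word [] \<notin> ?K" using that by force
    then show ?thesis by (simp add: c_def in_keys_iff)
  qed
  have "ncpoly_eval n f a = words_eval n W c a + c [] \<cdot>\<^sub>m 1\<^sub>m n"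
  proof (rule eq_matI)
    fix p q assume "p < dim_row (words_eval n W c a + c [] \<cdot>\<^sub>m 1\<^sub>m n)" "q < dim_col (words_eval n W c a + c [] \<cdot>\<^sub>m 1\<^sub>m n)"
    then have pq: "p < n" "q < n" by auto
    let ?g = "\<lambda>w. c w * word_mat n a w $$ (p, q)"
    have "ncpoly_eval n f a $$ (p, q) = sum ?g (letters ` ?K)"
      by (simp add: ncpoly_eval_words[OF a] words_eval_index[OF pq] c_def)
    also have "\<dots> = sum ?g (insert [] (letters ` ?K))"
      using c0 by (intro sum.mono_neutral_left) auto
    also have "\<dots> = ?g [] + sum ?g W"
      unfolding W_def by (subst sum.insert_remove) auto
    finally show "ncpoly_eval n f a $$ (p, q) = (words_eval n W c a + c [] \<cdot>\<^sub>m 1\<^sub>m n) $$ (p, q)"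
      using pq by (simp add: words_eval_index)
  qed (auto simp: ncpoly_eval_words[OF a] words_eval_def)
  then have "card (eigenvalues (ncpoly_eval n f a)) = n"
    using card_eigenvalues_add_scalar[OF words_eval_carrier simple] by simp
  then show ?thesis using a by (auto simp: ncpoly_image_def)
qed

theorem theorem3p1:
  fixes f :: "'a::{alg_closed_field, field_char_0} ncpoly"
    and m n :: nat
    and \<alpha>\<^sub>1 \<alpha>\<^sub>2 \<alpha>\<^sub>3 :: 'a
    and T :: "'a mat"
  assumes "ncpoly_degree f = m" and "m \<ge> 1"
    and "n \<ge> 2" and "n \<ge> m - 1"
    and "\<alpha>\<^sub>1 \<noteq> 0" and "\<alpha>\<^sub>2 \<noteq> 0" and "\<alpha>\<^sub>3 \<noteq> 0"
    and "\<alpha>\<^sub>1 + \<alpha>\<^sub>2 + \<alpha>\<^sub>3 = 0"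
    and "T \<in> carrier_mat n n" and "mat_trace T = 0"
  shows "\<exists>A\<^sub>1 \<in> ncpoly_image n f. \<exists>A\<^sub>2 \<in> ncpoly_image n f. \<exists>A\<^sub>3 \<in> ncpoly_image n f.
    T = \<alpha>\<^sub>1 \<cdot>\<^sub>m A\<^sub>1 + \<alpha>\<^sub>2 \<cdot>\<^sub>m A\<^sub>2 + \<alpha>\<^sub>3 \<cdot>\<^sub>m A\<^sub>3"
proof -
  \<comment> \<open>From \<open>m \<le> n + 1\<close>, and \<open>n + 1 < 2 * n\<close> because
    \<open>n \<ge> 2\<close>.\<close>
  have "m < 2 * n" using assms(3,4) by linarith
  then obtain A where A: "A \<in> ncpoly_image n f" "card (eigenvalues A) = n"
    using ncpoly_image_simple_spectrum[of f n] assms(1,2) by blast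
  note Ac = ncpoly_image_carrier[OF A(1)]
  obtain l where l: "bij_betw l {..<n} (eigenvalues A)"
    using ex_bij_betw_nat_finite[OF finite_eigenvalues[OF Ac]] A(2) by (auto simp: atLeast0LessThan)
  then have inj: "inj_on l {..<n}" and ev: "\<And>i. i < n \<Longrightarrow> eigenvalue A (l i)"
    by (auto simp: bij_betw_def eigenvalues_def)
  have sim: "similar_mat A (diag_of n l)" by (rule similar_diag_of[OF Ac inj ev])
  have "(\<Sum>i<n. T $$ (i, i)) = 0" using assms(9,10) by (simp add: mat_trace_def)
  from similar_zero_diagonal[OF assms(9) this] obtain Z
    where Z: "Z \<in> carrier_mat n n" "similar_mat T Z" "\<And>i. i < n \<Longrightarrow> Z $$ (i, i) = 0" by blast
  obtain P Q where wit: "similar_mat_wit T Z P Q" using Z(2) by (auto simp: similar_mat_def)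
  note PQ = similar_mat_witD2[OF assms(9) wit]
  define D\<^sub>1 where "D\<^sub>1 = mat n n (\<lambda>(i, j). if i = j then l i else if j < i then Z $$ (i, j) / \<alpha>\<^sub>1 else 0)"
  define D\<^sub>2 where "D\<^sub>2 = mat n n (\<lambda>(i, j). if i = j then l i else if i < j then Z $$ (i, j) / \<alpha>\<^sub>2 else 0)"
  define D\<^sub>3 where "D\<^sub>3 = diag_of n l"
  have D: "D\<^sub>1 \<in> carrier_mat n n" "D\<^sub>2 \<in> carrier_mat n n" "D\<^sub>3 \<in> carrier_mat n n"
    by (simp_all add: D\<^sub>1_def D\<^sub>2_def D\<^sub>3_def)
  have "similar_mat D\<^sub>1 (diag_of n l)" "similar_mat D\<^sub>2 (diag_of n l)" "similar_mat D\<^sub>3 (diag_of n l)"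
    by (rule similar_triangular[OF _ _ inj];
      force simp: D\<^sub>1_def D\<^sub>2_def D\<^sub>3_def diag_of_def upper_triangular_def)+
  then have D_sim: "similar_mat D\<^sub>1 A" "similar_mat D\<^sub>2 A" "similar_mat D\<^sub>3 A"
    using similar_mat_trans similar_mat_sym[OF sim] by blast+
  \<comment> \<open>The decomposition is found for \<open>Z\<close> and carried back to
    \<open>T\<close> by \<open>P\<close> and \<open>Q\<close>; each summand stays in the similarity
    class of \<open>A\<close>, hence in the image.\<close>
  have img: "P * B * Q \<in> ncpoly_image n f" if "B \<in> carrier_mat n n" "similar_mat B A" for B
  proof -
    have "similar_mat (P * B * Q) B" using that PQ by (intro similar_matI[of _ _ P Q n]) auto
    then show ?thesis using ncpoly_image_similar[OF A(1)] similar_mat_trans[OF _ that(2)] by blast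
  qed
  have "Z = \<alpha>\<^sub>1 \<cdot>\<^sub>m D\<^sub>1 + \<alpha>\<^sub>2 \<cdot>\<^sub>m D\<^sub>2 + \<alpha>\<^sub>3 \<cdot>\<^sub>m D\<^sub>3"
  proof (rule eq_matI)
    fix i j assume "i < dim_row (\<alpha>\<^sub>1 \<cdot>\<^sub>m D\<^sub>1 + \<alpha>\<^sub>2 \<cdot>\<^sub>m D\<^sub>2 + \<alpha>\<^sub>3 \<cdot>\<^sub>m D\<^sub>3)"
      "j < dim_col (\<alpha>\<^sub>1 \<cdot>\<^sub>m D\<^sub>1 + \<alpha>\<^sub>2 \<cdot>\<^sub>m D\<^sub>2 + \<alpha>\<^sub>3 \<cdot>\<^sub>m D\<^sub>3)"
    then have ij: "i < n" "j < n" using D by auto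
    \<comment> \<open>The common diagonal cancels, matching the zero diagonal of
      \<open>Z\<close>.\<close>
    have "\<alpha>\<^sub>1 * l i + \<alpha>\<^sub>2 * l i + \<alpha>\<^sub>3 * l i = 0"
      using assms(8) by (metis distrib_right mult_zero_left)
    then show "Z $$ (i, j) = (\<alpha>\<^sub>1 \<cdot>\<^sub>m D\<^sub>1 + \<alpha>\<^sub>2 \<cdot>\<^sub>m D\<^sub>2 + \<alpha>\<^sub>3 \<cdot>\<^sub>m D\<^sub>3) $$ (i, j)"
      using ij Z(3) assms(5,6) by (auto simp: D\<^sub>1_def D\<^sub>2_def D\<^sub>3_def diag_of_def)
  qed (use Z D in auto)
  then have "T = P * (\<alpha>\<^sub>1 \<cdot>\<^sub>m D\<^sub>1 + \<alpha>\<^sub>2 \<cdot>\<^sub>m D\<^sub>2 + \<alpha>\<^sub>3 \<cdot>\<^sub>m D\<^sub>3) * Q" using PQ by simp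
  also have "\<dots> = \<alpha>\<^sub>1 \<cdot>\<^sub>m (P * D\<^sub>1 * Q) + \<alpha>\<^sub>2 \<cdot>\<^sub>m (P * D\<^sub>2 * Q) + \<alpha>\<^sub>3 \<cdot>\<^sub>m (P * D\<^sub>3 * Q)"
    using PQ D by (simp add: mult_add_distrib_mat[of _ n n _ n] add_mult_distrib_mat[of _ n n _ _ n]
        mult_smult_distrib[of _ n n _ n] mult_smult_assoc_mat[of _ n n _ n] del: assoc_mult_mat)
  finally show ?thesis using img D D_sim by blast
qed

end
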